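(* $\operatorname{Im}(B)=E_1\cup E_2$, and both $E_1$ and $E_2$ are dense in $\operatorname{Im}(B)$ in the natural Fréchet topology of $H^{-1}_{\mathrm{loc}}(\mathbb{R})$.
   Context: The Miura map $B$ is $B(r)=r'+r^2$ (distributional derivative), a map from real-valued functions in $L^2_{\mathrm{loc}}(\mathbb{R})$ to the local Sobolev space $H^{-1}_{\mathrm{loc}}(\mathbb{R})$ (distributions $u$ with $\chi u\in H^{-1}(\mathbb{R})$ for all $\chi\in C_0^\infty(\mathbb{R})$); $\operatorname{Im}(B)$ is its image. Define $$E_1=\{q\in\operatorname{Im}(B): B^{-1}(q)\text{ consists of a single point}\},$$ $$E_2=\{q\in\operatorname{Im}(B): B^{-1}(q)\text{ is homeomorphic to an interval}\},$$ where $B^{-1}(q)=\{r\in L^2_{\mathrm{loc}}(\mathbb{R}) \text{ real-valued}: B(r)=q\}$ carries the topology induced from the natural Fréchet topology of $L^2_{\mathrm{loc}}(\mathbb{R})$, and an interval is understood to be nondegenerate (a line segment). *)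

theory Defs
  imports "HOL-Analysis.Analysis"
begin

definition test_functions :: "(real \<Rightarrow> real) set" where
  "test_functions =
     {\<phi>. (\<forall>k x. (deriv ^^ k) \<phi> field_differentiable (at x)) \<and> compact (closure {x. \<phi> x \<noteq> 0})}"

text \<open>
  Only real-valued functions and distributions occur, so a distribution is a real linear functional
  on real test functions. It is represented as a function that is \<^const>\<open>undefined\<close> off
  the test functions, so that equality in HOL is equality of distributions.
\<close>

type_synonym functional = "(real \<Rightarrow> real) \<Rightarrow> real"

definition distributions :: "functional set" where
  "distributions =
     {u \<in> extensional test_functions.
        (\<forall>\<phi>\<in>test_functions. \<forall>\<psi>\<in>test_functions. \<forall>a b.
           u (\<lambda>x. a * \<phi> x + b * \<psi> x) = a * u \<phi> + b * u \<psi>) \<and>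
        (\<forall>K. compact K \<longrightarrow>
           (\<exists>C N. \<forall>\<phi>\<in>test_functions. {x. \<phi> x \<noteq> 0} \<subseteq> K \<longrightarrow>
              \<bar>u \<phi>\<bar> \<le> C * (\<Sum>k\<le>N. SUP x. \<bar>(deriv ^^ k) \<phi> x\<bar>)))}"

definition dist_of_fun :: "(real \<Rightarrow> real) \<Rightarrow> functional" where
  "dist_of_fun f = (\<lambda>\<phi>\<in>test_functions. LINT x|lebesgue. f x * \<phi> x)"

definition dist_deriv :: "functional \<Rightarrow> functional" where
  "dist_deriv u = (\<lambda>\<phi>\<in>test_functions. - u (deriv \<phi>))"

definition dist_add :: "functional \<Rightarrow> functional \<Rightarrow> functional" where
  "dist_add u v = (\<lambda>\<phi>\<in>test_functions. u \<phi> + v \<phi>)"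

definition dist_diff :: "functional \<Rightarrow> functional \<Rightarrow> functional" where
  "dist_diff u v = (\<lambda>\<phi>\<in>test_functions. u \<phi> - v \<phi>)"

definition dist_mult :: "(real \<Rightarrow> real) \<Rightarrow> functional \<Rightarrow> functional" where
  "dist_mult \<eta> u = (\<lambda>\<phi>\<in>test_functions. u (\<lambda>x. \<eta> x * \<phi> x))"

text \<open>
  \<open>H\<^sup>-\<^sup>1(\<real>)\<close> is the dual of \<open>H\<^sup>1(\<real>)\<close>, with the dual norm. As the test functions are dense in
  \<open>H\<^sup>1(\<real>)\<close>, its elements are the distributions that are bounded for the \<open>H\<^sup>1\<close> norm.
\<close>

definition H1_norm :: "(real \<Rightarrow> real) \<Rightarrow> real" where
  "H1_norm \<phi> = sqrt (LINT x|lebesgue. (\<phi> x)\<^sup>2 + (deriv \<phi> x)\<^sup>2)"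

definition Hm1 :: "functional set" where
  "Hm1 = {u \<in> distributions. \<exists>C. \<forall>\<phi>\<in>test_functions. \<bar>u \<phi>\<bar> \<le> C * H1_norm \<phi>}"

definition Hm1_norm :: "functional \<Rightarrow> real" where
  "Hm1_norm u = (SUP \<phi>\<in>{\<phi> \<in> test_functions. H1_norm \<phi> \<le> 1}. \<bar>u \<phi>\<bar>)"

definition Hm1_loc :: "functional set" where
  "Hm1_loc = {u \<in> distributions. \<forall>\<eta>\<in>test_functions. dist_mult \<eta> u \<in> Hm1}"

text \<open>
  The topology of a carrier \<open>V\<close> with a family of seminorms, given by the pseudometrics
  \<open>d i x y = p i (x - y)\<close>. The balls form a subbasis.
\<close>

definition seminorm_topology :: "'a set \<Rightarrow> 'i set \<Rightarrow> ('i \<Rightarrow> 'a \<Rightarrow> 'a \<Rightarrow> real) \<Rightarrow> 'a topology" where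
  "seminorm_topology V I d =
     topology_generated_by {{y \<in> V. d i x y < e} | i x e. i \<in> I \<and> x \<in> V \<and> e > 0}"

definition Hm1_loc_topology :: "functional topology" where
  "Hm1_loc_topology =
     seminorm_topology Hm1_loc test_functions (\<lambda>\<eta> u v. Hm1_norm (dist_mult \<eta> (dist_diff u v)))"

definition L2_loc_functions :: "(real \<Rightarrow> real) set" where
  "L2_loc_functions =
     {f \<in> borel_measurable lebesgue. \<forall>K. compact K \<longrightarrow> set_integrable lebesgue K (\<lambda>x. (f x)\<^sup>2)}"

definition L2_loc_eq :: "(real \<Rightarrow> real) \<Rightarrow> (real \<Rightarrow> real) \<Rightarrow> bool" where
  "L2_loc_eq f g \<longleftrightarrow>
     f \<in> L2_loc_functions \<and> g \<in> L2_loc_functions \<and> (AE x in lebesgue. f x = g x)"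

quotient_type L2_loc = "real \<Rightarrow> real" / partial: L2_loc_eq
proof (rule part_equivpI)
  have "L2_loc_eq (\<lambda>_. 0) (\<lambda>_. 0)"
    by (simp add: L2_loc_eq_def L2_loc_functions_def set_integrable_def)
  then show "\<exists>f. L2_loc_eq f f" by blast
  show "symp L2_loc_eq"
    by (auto simp: symp_def L2_loc_eq_def elim: eventually_mono)
  show "transp L2_loc_eq"
    by (auto simp: transp_def L2_loc_eq_def elim: eventually_elim2)
qed

lift_definition L2_loc_dist :: "nat \<Rightarrow> L2_loc \<Rightarrow> L2_loc \<Rightarrow> real" is
  "\<lambda>n f g. sqrt (LINT x:{- real n..real n}|lebesgue. (f x - g x)\<^sup>2)"
proof -
  fix n f f' g g'
  assume *: "L2_loc_eq f f'" "L2_loc_eq g g'"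
  then have [measurable]: "f \<in> borel_measurable lebesgue" "f' \<in> borel_measurable lebesgue"
    "g \<in> borel_measurable lebesgue" "g' \<in> borel_measurable lebesgue"
    by (auto simp: L2_loc_eq_def L2_loc_functions_def)
  have [measurable]: "{- real n..real n} \<in> sets lebesgue"
    by simp
  have "AE x in lebesgue. f x = f' x" "AE x in lebesgue. g x = g' x"
    using * by (auto simp: L2_loc_eq_def)
  then have "AE x in lebesgue. (f x - g x)\<^sup>2 = (f' x - g' x)\<^sup>2"
    by eventually_elim simp
  then have "(LINT x:{- real n..real n}|lebesgue. (f x - g x)\<^sup>2) =
             (LINT x:{- real n..real n}|lebesgue. (f' x - g' x)\<^sup>2)"
    unfolding set_lebesgue_integral_def
    by (intro integral_cong_AE) (measurable, auto elim: eventually_mono)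
  then show "sqrt (LINT x:{- real n..real n}|lebesgue. (f x - g x)\<^sup>2) =
             sqrt (LINT x:{- real n..real n}|lebesgue. (f' x - g' x)\<^sup>2)"
    by simp
qed

definition L2_loc_topology :: "L2_loc topology" where
  "L2_loc_topology = seminorm_topology UNIV UNIV L2_loc_dist"

lemma test_function_measurable:
  assumes "\<phi> \<in> test_functions"
  shows "\<phi> \<in> borel_measurable lebesgue"
proof -
  have "\<phi> field_differentiable (at x)" for x
    using assms by (auto simp: test_functions_def dest!: spec[of _ "0::nat"])
  then have "continuous_on UNIV \<phi>"
    by (auto simp: continuous_on_eq_continuous_at intro: field_differentiable_imp_continuous_at)
  then have "\<phi> \<in> borel_measurable lborel"
    by (simp add: borel_measurable_continuous_onI)
  then show ?thesis
    by (rule measurable_completion)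
qed

lemma dist_of_fun_cong_AE:
  assumes [measurable]: "f \<in> borel_measurable lebesgue" "g \<in> borel_measurable lebesgue"
    and "AE x in lebesgue. f x = g x"
  shows "dist_of_fun f = dist_of_fun g"
  unfolding dist_of_fun_def
proof (rule restrict_ext)
  fix \<phi> assume "\<phi> \<in> test_functions"
  then have [measurable]: "\<phi> \<in> borel_measurable lebesgue"
    by (rule test_function_measurable)
  show "(LINT x|lebesgue. f x * \<phi> x) = (LINT x|lebesgue. g x * \<phi> x)"
    using assms(3) by (intro integral_cong_AE) (auto elim: eventually_mono)
qed

lift_definition miura :: "L2_loc \<Rightarrow> functional" is
  "\<lambda>r. dist_add (dist_deriv (dist_of_fun r)) (dist_of_fun (\<lambda>x. (r x)\<^sup>2))"
proof -
  fix r s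
  assume *: "L2_loc_eq r s"
  then have [measurable]: "r \<in> borel_measurable lebesgue" "s \<in> borel_measurable lebesgue"
    by (auto simp: L2_loc_eq_def L2_loc_functions_def)
  have "AE x in lebesgue. r x = s x"
    using * by (auto simp: L2_loc_eq_def)
  moreover from this have "AE x in lebesgue. (r x)\<^sup>2 = (s x)\<^sup>2"
    by eventually_elim simp
  ultimately have "dist_of_fun r = dist_of_fun s"
      "dist_of_fun (\<lambda>x. (r x)\<^sup>2) = dist_of_fun (\<lambda>x. (s x)\<^sup>2)"
    by (auto intro!: dist_of_fun_cong_AE)
  then show "dist_add (dist_deriv (dist_of_fun r)) (dist_of_fun (\<lambda>x. (r x)\<^sup>2)) =
             dist_add (dist_deriv (dist_of_fun s)) (dist_of_fun (\<lambda>x. (s x)\<^sup>2))"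
    by simp
qed

definition E1 :: "functional set" where
  "E1 = {q \<in> range miura. \<exists>r. miura -` {q} = {r}}"

text \<open>An interval is read as a line segment, i.e. nondegenerate and containing both end points.\<close>

definition E2 :: "functional set" where
  "E2 = {q \<in> range miura. \<exists>a b :: real. a < b \<and>
           subtopology L2_loc_topology (miura -` {q}) homeomorphic_space top_of_set {a..b}}"

end

theory Submission imports Defs begin

text \<open>
  Let \<open>B f = q\<close>, \<open>R' = f\<close> and \<open>I x = \<integral>\<^sub>0\<^sup>x exp (- 2 R)\<close>. If also \<open>B s = q\<close>, then \<open>w = s - f\<close>
  has a continuous representative with \<open>w' = - (s + f) w\<close>, so
  \<open>w = t exp (- 2 R - \<integral>\<^sub>0 w)\<close> with \<open>t = w 0\<close>. Hence \<open>E = exp (\<integral>\<^sub>0 w)\<close> satisfies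
  \<open>E' = t exp (- 2 R)\<close>, that is \<open>E = 1 + t I\<close>, and \<open>w = t exp (- 2 R) / (1 + t I)\<close>. Conversely every
  \<open>t\<close> with \<open>1 + t I > 0\<close> everywhere gives a preimage of \<open>q\<close>. These \<open>t\<close> form a compact interval
  containing \<open>0\<close>, and \<open>t \<mapsto> f + w\<close> is a continuous injection of it into a Hausdorff space.

  The interval is \<open>{0}\<close> if \<open>I\<close> is unbounded in both directions, for instance if \<open>f\<close> vanishes near
  both ends of the line, and it is nondegenerate if \<open>I\<close> is bounded above, for instance if \<open>f = 1\<close>
  near \<open>+\<infinity>\<close>. Neighbourhoods in \<open>H\<^sup>-\<^sup>1\<^sub>l\<^sub>o\<^sub>c\<close> only see a bounded interval, so both cases are dense.
\<close>

section \<open>Indefinite integrals of locally integrable functions\<close>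

text \<open>Since \<open>f\<close> is only locally square integrable, \<open>R\<close> is merely
  locally absolutely continuous, and the differential equations of the problem hold almost
  everywhere or weakly, not pointwise. This shapes the proof: the relation F' = f is expressed by
  integrals over intervals, it gets its own product rule and its own chain rule for the exponential,
  and testing against smooth functions matches it with the distributional derivative in the
  definition of B. Density rests on exact equality rather than on approximation. Each seminorm sees
  a distribution only through test functions with support in a fixed compact set, so changing a
  preimage far out leaves the relevant distances exactly as they were, while the growth of
  \<open>I\<close> at both ends can be prescribed.\<close>

definition locally_integrable :: "(real \<Rightarrow> real) \<Rightarrow> bool" where
  "locally_integrable f \<longleftrightarrow> (\<forall>a b. f absolutely_integrable_on {a..b})"

text \<open>This is local absolute continuity of \<open>F\<close> with derivative \<open>f\<close>,
  encoded by increments so that only integrals of \<open>f\<close> enter. Absolute integrability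
  here is Lebesgue integrability, so the gauge integral over intervals and the Bochner integral of
  the definitions can be exchanged.\<close>

definition primitive :: "(real \<Rightarrow> real) \<Rightarrow> (real \<Rightarrow> real) \<Rightarrow> bool" where
  "primitive F f \<longleftrightarrow> locally_integrable f \<and> (\<forall>a b. a \<le> b \<longrightarrow> integral {a..b} f = F b - F a)"

lemma locally_integrableD: "locally_integrable f \<Longrightarrow> f absolutely_integrable_on {a..b}"
  by (simp add: locally_integrable_def)

lemma locally_integrable_imp_integrable_on: "locally_integrable f \<Longrightarrow> f integrable_on {a..b}"
  by (simp add: locally_integrable_def absolutely_integrable_on_def)

lemma primitiveD:
  assumes "primitive F f"
  shows "locally_integrable f" "a \<le> b \<Longrightarrow> integral {a..b} f = F b - F a"
  using assms by (auto simp: primitive_def)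

lemma locally_integrable_add:
  "locally_integrable f \<Longrightarrow> locally_integrable g \<Longrightarrow> locally_integrable (\<lambda>x. f x + g x)"
  by (auto simp: locally_integrable_def intro: set_integral_add)

lemma locally_integrable_diff:
  "locally_integrable f \<Longrightarrow> locally_integrable g \<Longrightarrow> locally_integrable (\<lambda>x. f x - g x)"
  by (auto simp: locally_integrable_def intro: set_integral_diff)

lemma locally_integrable_abs: "locally_integrable f \<Longrightarrow> locally_integrable (\<lambda>x. \<bar>f x\<bar>)"
  by (simp add: locally_integrable_def set_integrable_abs)

lemma locally_integrable_continuous:
  "continuous_on UNIV f \<Longrightarrow> locally_integrable f"
  by (auto simp: locally_integrable_def intro!: absolutely_integrable_continuous_real intro: continuous_on_subset)

lemma locally_integrable_mult_continuous:
  assumes "continuous_on UNIV c" "locally_integrable f"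
  shows "locally_integrable (\<lambda>x. c x * f x)"
  unfolding locally_integrable_def
proof (intro allI absolutely_integrable_bounded_measurable_product_real)
  fix a b :: real
  have c: "continuous_on {a..b} c"
    using assms(1) continuous_on_subset by blast
  then show "c \<in> borel_measurable (lebesgue_on {a..b})"
    by (simp add: continuous_imp_measurable_on_sets_lebesgue)
  show "bounded (c ` {a..b})"
    using c compact_continuous_image compact_imp_bounded by blast
qed (use assms(2) in \<open>auto simp: locally_integrable_def\<close>)

lemma primitive_continuous:
  assumes "primitive F f"
  shows "continuous_on UNIV F"
proof -
  have "isCont F x" for x
  proof -
    have "continuous_on {x-1..x+1} (\<lambda>y. integral {x-1..y} f)"
      by (intro indefinite_integral_continuous_1 locally_integrable_imp_integrable_on primitiveD[OF assms])
    then have "continuous_on {x-1..x+1} (\<lambda>y. integral {x-1..y} f + F (x-1))"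
      by (intro continuous_intros)
    then have "continuous_on {x-1..x+1} F"
      by (rule continuous_on_eq) (simp add: primitiveD[OF assms])
    then have "continuous_on {x-1<..<x+1} F"
      by (rule continuous_on_subset) auto
    then show ?thesis
      by (simp add: continuous_on_eq_continuous_at)
  qed
  then show ?thesis
    by (simp add: continuous_at_imp_continuous_on)
qed

lemma primitive_exists:
  assumes "locally_integrable f"
  obtains F where "primitive F f" "F 0 = 0"
proof
  \<comment> \<open>The signed integral from 0 to \<open>x\<close>: for either sign of
    \<open>x\<close> one of the two intervals is empty or a point.\<close>
  let ?F = "\<lambda>x. integral {0..x} f - integral {x..0} f"
  have int: "f integrable_on {a..b}" for a b
    using assms by (rule locally_integrable_imp_integrable_on)
  have "integral {a..b} f = ?F b - ?F a" if "a \<le> b" for a b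
  proof -
    consider "0 \<le> a" | "a \<le> 0" "0 \<le> b" | "b \<le> 0" by linarith
    then show ?thesis
    proof cases
      case 1
      then have "{a..0} = (if a = 0 then {0} else {})" "{b..0} = (if b = 0 then {0} else {})"
          "b = 0 \<Longrightarrow> a = 0"
        using that by auto
      then show ?thesis
        using Henstock_Kurzweil_Integration.integral_combine[OF 1 that int] by simp
    next
      case 2
      then have "{b..0} = (if b = 0 then {0} else {})" "{0..a} = (if a = 0 then {0} else {})"
        by auto
      then show ?thesis
        using Henstock_Kurzweil_Integration.integral_combine[OF 2 int] by simp
    next
      case 3
      then have "{0..a} = (if a = 0 then {0} else {})" "{0..b} = (if b = 0 then {0} else {})"
          "a = 0 \<Longrightarrow> b = 0"
        using that by auto
      then show ?thesis
        using Henstock_Kurzweil_Integration.integral_combine[OF that 3 int] by simp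
    qed
  qed
  then show "primitive ?F f"
    using assms by (simp add: primitive_def)
  show "?F 0 = 0" by simp
qed

lemma primitive_add: "primitive F f \<Longrightarrow> primitive G g \<Longrightarrow> primitive (\<lambda>x. F x + G x) (\<lambda>x. f x + g x)"
  by (auto simp: primitive_def locally_integrable_add
      Henstock_Kurzweil_Integration.integral_add locally_integrable_imp_integrable_on)

lemma primitive_cmult:
  assumes "primitive F f"
  shows "primitive (\<lambda>x. c * F x) (\<lambda>x. c * f x)"
  using assms locally_integrable_mult_continuous[of "\<lambda>_. c" f]
  by (auto simp: primitive_def right_diff_distrib)

lemma primitive_eq:
  assumes "primitive F f" "primitive G f"
  shows "F x - F y = G x - G y"
  using primitiveD(2)[OF assms(1), of x y] primitiveD(2)[OF assms(2), of x y]
    primitiveD(2)[OF assms(1), of y x] primitiveD(2)[OF assms(2), of y x]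
  by (cases "x \<le> y") auto

text \<open>Representatives of \<open>L2_loc\<close> classes satisfy their equations only almost
  everywhere; this carries such identities into statements about primitives.\<close>

lemma primitive_cong_AE:
  assumes F: "primitive F f" and ae: "AE x in lebesgue. f x = g x" "g \<in> borel_measurable lebesgue"
  shows "primitive F g"
proof -
  obtain N where N: "negligible N" "\<And>x. x \<notin> N \<Longrightarrow> f x = g x"
    using ae unfolding completion.AE_iff_null_sets negligible_iff_null_sets by auto
  have "g absolutely_integrable_on {a..b}" for a b
    by (rule absolutely_integrable_spike[OF locally_integrableD[OF primitiveD(1)[OF F]] N(1)])
       (use N(2) in auto)
  moreover have "integral {a..b} g = integral {a..b} f" for a b
    by (rule integral_spike[OF N(1)]) (use N(2) in auto)
  ultimately show ?thesis
    using F by (simp add: primitive_def locally_integrable_def)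
qed

lemma primitive_of_continuous_deriv:
  assumes "\<And>x. (F has_real_derivative f x) (at x)" "continuous_on UNIV f"
  shows "primitive F f"
proof -
  have "(f has_integral (F b - F a)) {a..b}" if "a \<le> b" for a b
    using that by (intro fundamental_theorem_of_calculus)
      (auto simp: has_real_derivative_iff_has_vector_derivative[symmetric] assms(1) has_field_derivative_at_within)
  then show ?thesis
    by (auto simp: primitive_def locally_integrable_continuous[OF assms(2)])
qed

lemma primitive_imp_deriv:
  assumes "primitive F f" "continuous_on UNIV f"
  shows "(F has_real_derivative f x) (at x)"
proof -
  have "((\<lambda>y. integral {x-1..y} f) has_vector_derivative f x) (at x within {x-1..x+1})"
    by (rule integral_has_vector_derivative) (use assms(2) continuous_on_subset in auto)
  then have "((\<lambda>y. integral {x-1..y} f) has_real_derivative f x) (at x within {x-1<..<x+1})"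
    unfolding has_real_derivative_iff_has_vector_derivative
    by (rule has_vector_derivative_within_subset) auto
  then have "((\<lambda>y. integral {x-1..y} f) has_real_derivative f x) (at x)"
    by (subst (asm) at_within_open) auto
  then have "((\<lambda>y. integral {x-1..y} f + F (x-1)) has_real_derivative f x) (at x)"
    by (auto intro!: derivative_eq_intros)
  moreover have "\<forall>\<^sub>F y in nhds x. integral {x-1..y} f + F (x-1) = F y"
    by (rule eventually_mono[OF eventually_nhds_in_open[of "{x-1<..<x+1}" x]])
       (auto simp: primitiveD[OF assms(1)])
  ultimately show ?thesis
    by (simp cong: DERIV_cong_ev)
qed

text \<open>
  To first order at each point is enough, if the error is controlled by an additive interval
  function: the bisection argument behind \<open>Bolzano\<close> adds up the local errors.
\<close>

lemma primitiveI_local: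
  assumes h: "locally_integrable h" and M: "primitive M m"
    and step: "\<And>e x. e > 0 \<Longrightarrow> \<exists>d>0. \<forall>u v. u \<le> x \<and> x \<le> v \<and> v - u < d \<longrightarrow>
                  \<bar>H v - H u - integral {u..v} h\<bar> \<le> e * (M v - M u)"
  shows "primitive H h"
proof -
  have "integral {a..b} h = H b - H a" if "a \<le> b" for a b
  proof -
    have scaled: "\<bar>H b - H a - integral {a..b} h\<bar> \<le> e * (M b - M a)" if "e > 0" for e
      using \<open>a \<le> b\<close>
    proof (induction rule: Bolzano)
      case (trans a b c)
      then show ?case
        using Henstock_Kurzweil_Integration.integral_combine[OF trans(3,4) locally_integrable_imp_integrable_on[OF h]]
        by (auto simp: algebra_simps)
    next
      case (local x)
      then show ?case
        using step[OF that, of x] by blast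
    qed
    then have "\<bar>H b - H a - integral {a..b} h\<bar> \<le> e" if "e > 0" for e
    proof -
      \<comment> \<open>The added 1 keeps the quotient meaningful when \<open>M\<close> does not
        grow over the interval.\<close>
      have "\<bar>H b - H a - integral {a..b} h\<bar> \<le> e / (\<bar>M b - M a\<bar> + 1) * (M b - M a)"
        using that by (intro scaled) (simp add: add_nonneg_pos)
      also have "\<dots> \<le> e / (\<bar>M b - M a\<bar> + 1) * (\<bar>M b - M a\<bar> + 1)"
        using that by (intro mult_left_mono) auto
      finally show ?thesis by (simp add: add_nonneg_eq_0_iff)
    qed
    from field_le_epsilon[of "\<bar>H b - H a - integral {a..b} h\<bar>" 0] this show ?thesis by auto
  qed
  then show ?thesis
    using h by (simp add: primitive_def)
qed

section \<open>Product rule and chain rule for indefinite integrals\<close>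

lemma abs_integral_mult_le:
  fixes f k :: "real \<Rightarrow> real"
  assumes "locally_integrable f" "locally_integrable (\<lambda>x. k x * f x)"
    and "\<And>x. x \<in> {u..v} \<Longrightarrow> \<bar>k x\<bar> \<le> e"
  shows "\<bar>integral {u..v} (\<lambda>x. k x * f x)\<bar> \<le> e * integral {u..v} (\<lambda>x. \<bar>f x\<bar>)"
proof -
  have "norm (integral {u..v} (\<lambda>x. k x * f x)) \<le> integral {u..v} (\<lambda>x. e * \<bar>f x\<bar>)"
  proof (rule integral_norm_bound_integral)
    show "(\<lambda>x. e * \<bar>f x\<bar>) integrable_on {u..v}"
      using locally_integrable_imp_integrable_on[OF locally_integrable_abs[OF assms(1)]]
      by (intro integrable_on_mult_right) auto
  qed (use assms in \<open>auto simp: locally_integrable_imp_integrable_on abs_mult intro: mult_right_mono\<close>)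
  then show ?thesis by simp
qed

lemma continuous_real_eps_delta:
  fixes F :: "real \<Rightarrow> real"
  assumes "continuous_on UNIV F" "e > 0"
  obtains d where "d > 0" "\<And>y. \<bar>y - x\<bar> < d \<Longrightarrow> \<bar>F y - F x\<bar> < e"
proof -
  from assms(1) have "isCont F x"
    by (simp add: continuous_on_eq_continuous_at)
  then show thesis
    using assms(2) that unfolding continuous_at_eps_delta dist_real_def by blast
qed

lemma primitive_mult:
  assumes F: "primitive F f" and G: "primitive G g"
  shows "primitive (\<lambda>x. F x * G x) (\<lambda>x. G x * f x + F x * g x)"
proof -
  note cont = primitive_continuous[OF F] primitive_continuous[OF G]
  note li = primitiveD(1)[OF F] primitiveD(1)[OF G]
  let ?h = "\<lambda>x. G x * f x + F x * g x"
  obtain M where M: "primitive M (\<lambda>x. \<bar>f x\<bar> + \<bar>g x\<bar>)"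
    using primitive_exists[OF locally_integrable_add[OF locally_integrable_abs[OF li(1)] locally_integrable_abs[OF li(2)]]]
    by metis
  show ?thesis
  proof (rule primitiveI_local[OF _ M])
    show h: "locally_integrable ?h"
      by (intro locally_integrable_add locally_integrable_mult_continuous cont li)
    fix e x :: real assume e: "e > 0"
    \<comment> \<open>Half of \<open>e\<close>, since values at two points of \<open>{u..v}\<close>
      are compared through the value at \<open>x\<close>.\<close>
    obtain d1 where d1: "d1 > 0" "\<And>y. \<bar>y - x\<bar> < d1 \<Longrightarrow> \<bar>F y - F x\<bar> < e/2"
      using continuous_real_eps_delta[OF cont(1), of "e/2"] e by auto
    obtain d2 where d2: "d2 > 0" "\<And>y. \<bar>y - x\<bar> < d2 \<Longrightarrow> \<bar>G y - G x\<bar> < e/2"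
      using continuous_real_eps_delta[OF cont(2), of "e/2"] e by auto
    note d = d1(1) d2(1) d1(2) d2(2)
    show "\<exists>d>0. \<forall>u v. u \<le> x \<and> x \<le> v \<and> v - u < d \<longrightarrow>
             \<bar>F v * G v - F u * G u - integral {u..v} ?h\<bar> \<le> e * (M v - M u)"
    proof (intro exI[of _ "min d1 d2"] conjI allI impI)
      fix u v assume uv: "u \<le> x \<and> x \<le> v \<and> v - u < min d1 d2"
      then have near: "\<bar>F s - F t\<bar> \<le> e" "\<bar>G s - G t\<bar> \<le> e" if "s \<in> {u..v}" "t \<in> {u..v}" for s t
      proof -
        have "\<bar>t - x\<bar> < d1" "\<bar>s - x\<bar> < d1" "\<bar>t - x\<bar> < d2" "\<bar>s - x\<bar> < d2"
          using uv that by auto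
        from this(1,2)[THEN d(3)] this(3,4)[THEN d(4)] show "\<bar>F s - F t\<bar> \<le> e" "\<bar>G s - G t\<bar> \<le> e"
          by linarith+
      qed
      have cG: "continuous_on UNIV (\<lambda>t. G v - G t)" and cF: "continuous_on UNIV (\<lambda>t. F u - F t)"
        by (intro continuous_intros cont)+
      note li1 = locally_integrable_mult_continuous[OF cG li(1)]
        and li2 = locally_integrable_mult_continuous[OF cF li(2)]
      have "F v * G v - F u * G u = G v * (F v - F u) + F u * (G v - G u)"
        by (simp add: algebra_simps)
      also have "\<dots> = integral {u..v} (\<lambda>t. G v * f t) + integral {u..v} (\<lambda>t. F u * g t)"
        using uv by (simp add: primitiveD[OF F] primitiveD[OF G])
      also have "\<dots> = integral {u..v} (\<lambda>t. G v * f t + F u * g t)"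
        by (intro Henstock_Kurzweil_Integration.integral_add[symmetric] integrable_on_mult_right
              locally_integrable_imp_integrable_on li)
      finally have "F v * G v - F u * G u - integral {u..v} ?h
          = integral {u..v} (\<lambda>t. G v * f t + F u * g t) - integral {u..v} ?h"
        by simp
      also have "\<dots> = integral {u..v} (\<lambda>t. (G v * f t + F u * g t) - ?h t)"
        by (intro Henstock_Kurzweil_Integration.integral_diff[symmetric] integrable_add
              integrable_on_mult_right locally_integrable_imp_integrable_on li h)
      also have "\<dots> = integral {u..v} (\<lambda>t. (G v - G t) * f t + (F u - F t) * g t)"
        by (simp add: algebra_simps)
      also have "\<dots> = integral {u..v} (\<lambda>t. (G v - G t) * f t) + integral {u..v} (\<lambda>t. (F u - F t) * g t)"
        by (intro Henstock_Kurzweil_Integration.integral_add locally_integrable_imp_integrable_on li1 li2)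
      also have "\<bar>\<dots>\<bar> \<le> e * integral {u..v} (\<lambda>t. \<bar>f t\<bar>) + e * integral {u..v} (\<lambda>t. \<bar>g t\<bar>)"
        using uv by (intro order_trans[OF abs_triangle_ineq] add_mono
            abs_integral_mult_le li li1 li2 near) auto
      also have "\<dots> = e * integral {u..v} (\<lambda>t. \<bar>f t\<bar> + \<bar>g t\<bar>)"
        by (subst Henstock_Kurzweil_Integration.integral_add)
           (auto simp: algebra_simps intro: locally_integrable_imp_integrable_on locally_integrable_abs li)
      also have "\<dots> = e * (M v - M u)"
        using uv by (simp add: primitiveD[OF M])
      finally show "\<bar>F v * G v - F u * G u - integral {u..v} ?h\<bar> \<le> e * (M v - M u)" .
    qed (use d in auto)
  qed
qed

text \<open>The mean value theorem is applied to the exponential between the numbers F(u) and F(v),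
  not to the composite, because \<open>F\<close> need not be differentiable. The intermediate factor
  exp(z) is then compared with exp(F(t)) under the integral.\<close>

lemma primitive_exp:
  assumes F: "primitive F f"
  shows "primitive (\<lambda>x. exp (F x)) (\<lambda>x. exp (F x) * f x)"
proof -
  have cont: "continuous_on UNIV (\<lambda>x. exp (F x))"
    by (intro continuous_intros primitive_continuous[OF F])
  note li = primitiveD(1)[OF F]
  let ?h = "\<lambda>x. exp (F x) * f x"
  obtain M where M: "primitive M (\<lambda>x. \<bar>f x\<bar>)"
    using primitive_exists[OF locally_integrable_abs[OF li]] by metis
  show ?thesis
  proof (rule primitiveI_local[OF _ M])
    show h: "locally_integrable ?h"
      by (intro locally_integrable_mult_continuous cont li)
    fix e x :: real assume e: "e > 0"
    obtain d where d: "d > 0" "\<And>y. \<bar>y - x\<bar> < d \<Longrightarrow> \<bar>exp (F y) - exp (F x)\<bar> < e/2"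
      using continuous_real_eps_delta[OF cont, of "e/2"] e by auto
    show "\<exists>d>0. \<forall>u v. u \<le> x \<and> x \<le> v \<and> v - u < d \<longrightarrow>
             \<bar>exp (F v) - exp (F u) - integral {u..v} ?h\<bar> \<le> e * (M v - M u)"
    proof (intro exI[of _ d] conjI allI impI)
      fix u v assume uv: "u \<le> x \<and> x \<le> v \<and> v - u < d"
      \<comment> \<open>\<open>F\<close> is not monotone, so F(u) and F(v) may come in either order
        or coincide.\<close>
      have "\<exists>z. exp (F v) - exp (F u) = exp z * (F v - F u) \<and> min (F u) (F v) \<le> z \<and> z \<le> max (F u) (F v)"
      proof (cases "F u = F v")
        case False
        have "\<exists>z. min a b < z \<and> z < max a b \<and> exp (max a b) - exp (min a b) = (max a b - min a b) * exp z"
          if "a \<noteq> b" for a b :: real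
          using that by (intro MVT2) (auto intro!: derivative_eq_intros)
        from this[OF False] obtain z where z: "min (F u) (F v) < z" "z < max (F u) (F v)"
            "exp (max (F u) (F v)) - exp (min (F u) (F v)) = (max (F u) (F v) - min (F u) (F v)) * exp z"
          by blast
        then have "exp (F v) - exp (F u) = exp z * (F v - F u)"
          by (auto simp: min_def max_def algebra_simps split: if_splits)
        with z show ?thesis by (intro exI[of _ z]) auto
      qed auto
      then obtain z where z: "exp (F v) - exp (F u) = exp z * (F v - F u)"
         "min (F u) (F v) \<le> z" "z \<le> max (F u) (F v)" by blast
      then have "min (exp (F u)) (exp (F v)) \<le> exp z" "exp z \<le> max (exp (F u)) (exp (F v))"
        by (auto simp: min_def max_def split: if_splits)
      then have near: "\<bar>exp z - exp (F t)\<bar> \<le> e" if "t \<in> {u..v}" for t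
      proof -
        have "\<bar>t - x\<bar> < d" "\<bar>u - x\<bar> < d" "\<bar>v - x\<bar> < d"
          using uv that by auto
        from this[THEN d(2)] \<open>min _ _ \<le> exp z\<close> \<open>exp z \<le> max _ _\<close> show ?thesis
          by linarith
      qed
      have cF: "continuous_on UNIV (\<lambda>t. exp z - exp (F t))"
        by (intro continuous_intros cont)
      note li1 = locally_integrable_mult_continuous[OF cF li(1)]
      have "exp (F v) - exp (F u) - integral {u..v} ?h
          = integral {u..v} (\<lambda>t. exp z * f t) - integral {u..v} ?h"
        using uv by (simp add: primitiveD[OF F] z)
      also have "\<dots> = integral {u..v} (\<lambda>t. exp z * f t - ?h t)"
        by (intro Henstock_Kurzweil_Integration.integral_diff[symmetric]
              integrable_on_mult_right locally_integrable_imp_integrable_on li h)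
      also have "\<dots> = integral {u..v} (\<lambda>t. (exp z - exp (F t)) * f t)"
        by (simp add: algebra_simps)
      also have "\<bar>\<dots>\<bar> \<le> e * integral {u..v} (\<lambda>t. \<bar>f t\<bar>)"
        using near by (intro abs_integral_mult_le li li1)
      also have "\<dots> = e * (M v - M u)"
        using uv by (simp add: primitiveD[OF M])
      finally show "\<bar>exp (F v) - exp (F u) - integral {u..v} ?h\<bar> \<le> e * (M v - M u)" .
    qed (use d in auto)
  qed
qed

text \<open>
  As \<open>h\<close> has integral zero over the tagged intervals, Henstock's lemma bounds the Riemann sums
  of \<open>\<bar>h\<bar>\<close>.
\<close>

lemma AE_zero_of_interval_integrals:
  assumes li: "locally_integrable h" and zero: "\<And>a b. a \<le> b \<Longrightarrow> integral {a..b} h = 0"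
  shows "AE x in lebesgue. h x = 0"
proof -
  have "AE x in lebesgue. x \<in> {a..b} \<longrightarrow> h x = 0" for a b
  proof -
    have "((\<lambda>x. \<bar>h x\<bar>) has_integral 0) (cbox a b)"
      unfolding has_integral
    proof (intro allI impI)
      fix e :: real assume "e > 0"
      obtain \<gamma> where \<gamma>: "gauge \<gamma>" "\<And>p. \<lbrakk>p tagged_partial_division_of (cbox a b); \<gamma> fine p\<rbrakk> \<Longrightarrow>
             sum (\<lambda>(x,k). norm(measure lborel k *\<^sub>R h x - integral k h)) p < e"
        using Henstock_lemma[of h a b e] \<open>e > 0\<close> locally_integrable_imp_integrable_on[OF li] by auto
      show "\<exists>\<gamma>. gauge \<gamma> \<and> (\<forall>\<D>. \<D> tagged_division_of cbox a b \<and> \<gamma> fine \<D> \<longrightarrow>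
              norm ((\<Sum>(x, k)\<in>\<D>. measure lborel k *\<^sub>R \<bar>h x\<bar>) - 0) < e)"
      proof (intro exI conjI allI impI)
        fix p assume p: "p tagged_division_of cbox a b \<and> \<gamma> fine p"
        have "norm ((\<Sum>(x, k)\<in>p. measure lborel k *\<^sub>R \<bar>h x\<bar>) - 0)
            \<le> (\<Sum>(x, k)\<in>p. norm (measure lborel k *\<^sub>R \<bar>h x\<bar>))"
          unfolding diff_0_right case_prod_unfold by (rule norm_sum)
        also have "\<dots> = (\<Sum>(x, k)\<in>p. norm (measure lborel k *\<^sub>R h x - integral k h))"
        proof (rule sum.cong[OF refl], safe)
          fix x k assume "(x, k) \<in> p"
          then obtain u v where uv: "k = cbox u v" "x \<in> k"
            using p by (meson tagged_division_ofD(2,4))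
          then have "integral k h = 0"
            using zero[of u v] by auto
          then show "norm (measure lborel k *\<^sub>R \<bar>h x\<bar>) = norm (measure lborel k *\<^sub>R h x - integral k h)"
            by (simp add: abs_mult)
        qed
        also have "\<dots> < e"
          using p by (intro \<gamma>(2)) (auto simp: tagged_division_of_def)
        finally show "norm ((\<Sum>(x, k)\<in>p. measure lborel k *\<^sub>R \<bar>h x\<bar>) - 0) < e" .
      qed (fact \<gamma>(1))
    qed
    then have "integral {a..b} (\<lambda>x. \<bar>h x\<bar>) = 0"
      by (simp add: integral_unique)
    moreover have si: "set_integrable lebesgue {a..b} (\<lambda>x. \<bar>h x\<bar>)"
      using locally_integrable_abs[OF li] by (rule locally_integrableD)
    ultimately have "(LINT x|lebesgue. indicator {a..b} x * \<bar>h x\<bar>) = 0"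
      using set_lebesgue_integral_eq_integral(2)[OF si] by (simp add: set_lebesgue_integral_def)
    moreover have "integrable lebesgue (\<lambda>x. indicator {a..b} x * \<bar>h x\<bar>)"
      using si by (simp add: set_integrable_def)
    ultimately have "AE x in lebesgue. indicator {a..b} x * \<bar>h x\<bar> = 0"
      by (subst (asm) integral_nonneg_eq_0_iff_AE) auto
    then show ?thesis
      by eventually_elim (auto simp: indicator_def)
  qed
  then have "AE x in lebesgue. \<forall>n. x \<in> {-real n..real n} \<longrightarrow> h x = 0"
    by (subst AE_all_countable) blast
  then show ?thesis
  proof eventually_elim
    case (elim x)
    obtain n where "\<bar>x\<bar> \<le> real n"
      using real_arch_simple by blast
    then show ?case using elim by (auto simp: abs_le_iff)
  qed
qed

section \<open>Test functions and weak derivatives\<close>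

definition smooth :: "(real \<Rightarrow> real) \<Rightarrow> bool" where
  "smooth f \<longleftrightarrow> (\<forall>k x. (deriv ^^ k) f field_differentiable (at x))"

lemma smooth_deriv: "smooth f \<Longrightarrow> smooth (deriv f)"
  unfolding smooth_def by (metis comp_apply funpow_Suc_right)

lemma smooth_differentiable: "smooth f \<Longrightarrow> f field_differentiable (at x)"
  unfolding smooth_def by (metis funpow_0)

lemma smooth_DERIV: "smooth f \<Longrightarrow> (f has_real_derivative deriv f x) (at x)"
  using DERIV_deriv_iff_field_differentiable smooth_differentiable by blast

lemma smooth_continuous: "smooth f \<Longrightarrow> continuous_on UNIV f"
  by (metis DERIV_isCont continuous_at_imp_continuous_on smooth_DERIV)

text \<open>A set of functions that is closed under differentiation contains all iterated
  derivatives of its members. Closure properties of smoothness thus reduce to finding an invariant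
  set, without formulas for higher derivatives.\<close>

lemma smooth_coinduct:
  assumes "f \<in> S"
    and step: "\<And>f. f \<in> S \<Longrightarrow> \<exists>g\<in>S. \<forall>x. (f has_real_derivative g x) (at x)"
  shows "smooth f"
proof -
  have "(deriv ^^ k) f \<in> S" for k
  proof (induction k)
    case (Suc k)
    then obtain g where "g \<in> S" "\<And>x. ((deriv ^^ k) f has_real_derivative g x) (at x)"
      using step by blast
    moreover from this have "deriv ((deriv ^^ k) f) = g"
      by (intro ext DERIV_imp_deriv)
    ultimately show ?case by simp
  qed (use assms in simp)
  then show ?thesis
    using step unfolding smooth_def field_differentiable_def by blast
qed

text \<open>The derivative of a product is a sum of two products, so products alone are not
  invariant under differentiation; their finite sums are.\<close>

inductive_set smooth_sums_of_products :: "(real \<Rightarrow> real) set" where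
  prod: "smooth f \<Longrightarrow> smooth g \<Longrightarrow> (\<lambda>x. f x * g x) \<in> smooth_sums_of_products"
| sum: "f \<in> smooth_sums_of_products \<Longrightarrow> g \<in> smooth_sums_of_products \<Longrightarrow>
    (\<lambda>x. f x + g x) \<in> smooth_sums_of_products"

lemma smooth_sums_of_products: "f \<in> smooth_sums_of_products \<Longrightarrow> smooth f"
proof (erule smooth_coinduct)
  fix f assume "f \<in> smooth_sums_of_products"
  then show "\<exists>g\<in>smooth_sums_of_products. \<forall>x. (f has_real_derivative g x) (at x)"
  proof induction
    case (prod f g)
    show ?case
    proof
      show "\<forall>x. ((\<lambda>x. f x * g x) has_real_derivative f x * deriv g x + deriv f x * g x) (at x)"
        using DERIV_mult'[OF smooth_DERIV[OF prod(1)] smooth_DERIV[OF prod(2)]] by blast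
      show "(\<lambda>x. f x * deriv g x + deriv f x * g x) \<in> smooth_sums_of_products"
        by (intro smooth_sums_of_products.intros smooth_deriv prod)
    qed
  next
    case (sum f g)
    then obtain f' g' where fg: "f' \<in> smooth_sums_of_products" "g' \<in> smooth_sums_of_products"
       and *: "\<And>x. (f has_real_derivative f' x) (at x)" "\<And>x. (g has_real_derivative g' x) (at x)"
      by blast
    show ?case
    proof
      show "\<forall>x. ((\<lambda>x. f x + g x) has_real_derivative f' x + g' x) (at x)"
        by (intro allI DERIV_add *)
      show "(\<lambda>x. f' x + g' x) \<in> smooth_sums_of_products"
        by (intro smooth_sums_of_products.intros fg)
    qed
  qed
qed

lemma smooth_mult: "smooth f \<Longrightarrow> smooth g \<Longrightarrow> smooth (\<lambda>x. f x * g x)"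
  by (rule smooth_sums_of_products, rule smooth_sums_of_products.prod)

lemma smooth_const: "smooth (\<lambda>x. c)"
  by (rule smooth_coinduct[where S = "range (\<lambda>c x. c)"]) (auto intro!: derivative_eq_intros)

lemma smooth_add:
  assumes "smooth f" "smooth g"
  shows "smooth (\<lambda>x. f x + g x)"
proof -
  \<comment> \<open>Writing each summand as a product with the constant 1 makes the sum a member of
    the invariant set.\<close>
  have "(\<lambda>x. 1 * f x + 1 * g x) \<in> smooth_sums_of_products"
    by (intro smooth_sums_of_products.intros smooth_const assms)
  then show ?thesis
    using smooth_sums_of_products by simp
qed

lemma smooth_antideriv:
  assumes "\<And>x. (F has_real_derivative f x) (at x)" "smooth f"
  shows "smooth F"
proof (rule smooth_coinduct[where S = "insert F {f. smooth f}"])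
  fix g assume "g \<in> insert F {f. smooth f}"
  then show "\<exists>h\<in>insert F {f. smooth f}. \<forall>x. (g has_real_derivative h x) (at x)"
    using assms smooth_DERIV smooth_deriv by blast
qed simp

lemma smooth_affine:
  assumes "smooth f"
  shows "smooth (\<lambda>x. f (a * x + b))"
\<comment> \<open>The factor \<open>c\<close> absorbs the powers of \<open>a\<close> that the chain
  rule produces.\<close>
proof (rule smooth_coinduct[where S = "{\<lambda>x. c * f (a * x + b) | c f. smooth f}"])
  show "(\<lambda>x. f (a * x + b)) \<in> {\<lambda>x. c * f (a * x + b) |c f. smooth f}"
    using assms by (auto intro!: exI[of _ 1] exI[of _ f])
  fix g assume "g \<in> {\<lambda>x. c * f (a * x + b) |c f. smooth f}"
  then obtain c f where g: "g = (\<lambda>x. c * f (a * x + b))" "smooth f" by blast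
  have "(g has_real_derivative c * a * deriv f (a * x + b)) (at x)" for x
    unfolding g by (auto intro!: derivative_eq_intros DERIV_chain2[of f] smooth_DERIV g)
  then show "\<exists>h\<in>{\<lambda>x. c * f (a * x + b) |c f. smooth f}. \<forall>x. (g has_real_derivative h x) (at x)"
    using smooth_deriv[OF g(2)]
    by (intro bexI[of _ "\<lambda>x. c * a * deriv f (a * x + b)"])
       (auto intro!: exI[of _ "c * a"] exI[of _ "deriv f"])
qed

text \<open>The classical smooth function that is positive on the right half line and vanishes to
  infinite order at 0.\<close>

definition flat_exp :: "real \<Rightarrow> real" where
  "flat_exp x = (if x > 0 then exp (- (1 / x)) else 0)"

text \<open>The expression is the right difference quotient at 0 of p(1/x) exp(-1/x). With y = 1/x
  it is a combination of powers of y divided by exp(y).\<close>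

lemma poly_inverse_times_exp_tendsto:
  "((\<lambda>x. poly p (1 / x) * exp (- (1 / x)) / x) \<longlongrightarrow> 0) (at_right (0::real))"
proof -
  have "((\<lambda>y. coeff p i * (y ^ Suc i / exp y)) \<longlongrightarrow> 0) at_top" for i
    using tendsto_mult_left[OF tendsto_power_div_exp_0[of "Suc i"], of "coeff p i"] by simp
  then have "((\<lambda>y. \<Sum>i\<le>degree p. coeff p i * (y ^ Suc i / exp y)) \<longlongrightarrow> 0) at_top"
    by (rule tendsto_null_sum)
  moreover have "(\<Sum>i\<le>degree p. coeff p i * (y ^ Suc i / exp y)) = poly p y * exp (- y) * y" for y
    by (simp add: poly_altdef exp_minus divide_inverse sum_distrib_left sum_distrib_right ac_simps)
  ultimately have "((\<lambda>y. poly p y * exp (- y) * y) \<longlongrightarrow> 0) at_top"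
    by simp
  then have "((\<lambda>x. poly p (inverse x) * exp (- inverse x) * inverse x) \<longlongrightarrow> 0) (at_right 0)"
    by (rule filterlim_compose) (rule filterlim_inverse_at_top_right)
  then show ?thesis
    by (simp add: divide_inverse)
qed

lemma smooth_flat_exp: "smooth flat_exp"
proof -
  define f where "f p = (\<lambda>x::real. if x > 0 then poly p (1 / x) * exp (- (1 / x)) else 0)" for p
  \<comment> \<open>The functions \<open>f p\<close> form the invariant family: both 1/x in
    \<open>p\<close> and 1/x in the exponent contribute a factor 1/x^2, which is the polynomial
    \<open>[:0, 0, 1:]\<close> at 1/x, with opposite signs.\<close>
  have "(f p has_real_derivative f ([:0, 0, 1:] * (p - pderiv p)) x) (at x)" for p x
  proof -
    consider "x > 0" | "x < 0" | "x = 0" by linarith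
    then show ?thesis
    proof cases
      case 1
      have "((\<lambda>x. poly p (1 / x) * exp (- (1 / x))) has_real_derivative
              poly ([:0, 0, 1:] * (p - pderiv p)) (1 / x) * exp (- (1 / x))) (at x)"
        using 1 by (auto intro!: derivative_eq_intros DERIV_chain2[OF poly_DERIV]
            simp: field_simps power2_eq_square)
      then have "(f p has_real_derivative
              poly ([:0, 0, 1:] * (p - pderiv p)) (1 / x) * exp (- (1 / x))) (at x)"
        by (rule has_field_derivative_transform_within_open[of _ _ _ "{0<..}"]) (use 1 in \<open>auto simp: f_def\<close>)
      then show ?thesis using 1 by (simp add: f_def)
    next
      case 2
      have "(f p has_real_derivative 0) (at x)"
        by (rule has_field_derivative_transform_within_open[of "\<lambda>_. 0" _ _ "{..<0}"])
           (use 2 in \<open>auto simp: f_def\<close>)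
      then show ?thesis using 2 by (simp add: f_def)
    next
      case 3
      have "((\<lambda>h. (f p (x + h) - f p x) / h) \<longlongrightarrow> 0) (at_right 0)"
      proof (rule Lim_transform_eventually[OF poly_inverse_times_exp_tendsto[of p]])
        show "\<forall>\<^sub>F h in at_right 0. poly p (1 / h) * exp (- (1 / h)) / h = (f p (x + h) - f p x) / h"
          by (rule eventually_at_rightI[of 0 1]) (auto simp: f_def 3)
      qed
      moreover have "((\<lambda>h. (f p (x + h) - f p x) / h) \<longlongrightarrow> 0) (at_left 0)"
      proof (rule Lim_transform_eventually[OF tendsto_const])
        show "\<forall>\<^sub>F h in at_left 0. 0 = (f p (x + h) - f p x) / h"
          by (rule eventually_at_leftI[of "-1"]) (auto simp: f_def 3)
      qed
      ultimately have "((\<lambda>h. (f p (x + h) - f p x) / h) \<longlongrightarrow> 0) (at 0)"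
        by (rule filterlim_split_at[rotated])
      then show ?thesis
        unfolding DERIV_def by (simp add: 3) (simp add: f_def)
    qed
  qed
  then have "smooth (f 1)"
    by (intro smooth_coinduct[where S = "range f"]) auto
  moreover have "f 1 = flat_exp"
    by (auto simp: f_def flat_exp_def)
  ultimately show ?thesis by simp
qed

section \<open>Test functions and integration by parts\<close>

lemma test_functions_iff:
  "\<phi> \<in> test_functions \<longleftrightarrow> smooth \<phi> \<and> (\<exists>K. \<forall>x. \<phi> x \<noteq> 0 \<longrightarrow> \<bar>x\<bar> \<le> K)"
proof -
  have "compact (closure {x. \<phi> x \<noteq> 0}) \<longleftrightarrow> (\<exists>K. \<forall>x. \<phi> x \<noteq> 0 \<longrightarrow> \<bar>x\<bar> \<le> K)"
    by (auto simp: bounded_iff)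
  then show ?thesis
    by (simp add: test_functions_def smooth_def)
qed

lemma deriv_eq_0_outside:
  fixes \<phi> :: "real \<Rightarrow> real"
  assumes "\<And>x. K < \<bar>x\<bar> \<Longrightarrow> \<phi> x = 0" "K < \<bar>x\<bar>"
  shows "deriv \<phi> x = 0"
proof -
  have "open {x. K < \<bar>x\<bar>}"
    by (intro open_Collect_less continuous_intros)
  then have "(\<phi> has_real_derivative 0) (at x)"
    by (rule has_field_derivative_transform_within_open[of "\<lambda>_. 0" _ _ "{x. K < \<bar>x\<bar>}", rotated])
       (use assms in force)+
  then show ?thesis
    by (rule DERIV_imp_deriv)
qed

lemma test_function_support:
  assumes "\<phi> \<in> test_functions"
  obtains N :: nat where "\<And>x. real N \<le> \<bar>x\<bar> \<Longrightarrow> \<phi> x = 0" "\<And>x. real N \<le> \<bar>x\<bar> \<Longrightarrow> deriv \<phi> x = 0"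
proof -
  obtain K where K: "\<And>x. \<phi> x \<noteq> 0 \<Longrightarrow> \<bar>x\<bar> \<le> K"
    using assms by (auto simp: test_functions_iff)
  \<comment> \<open>The inequality is strict so that the derivative vanishes at the points N and -N
    as well.\<close>
  obtain N :: nat where N: "K < real N"
    using reals_Archimedean2 by blast
  show thesis
  proof
    fix x assume x: "real N \<le> \<bar>x\<bar>"
    then show "\<phi> x = 0" using K[of x] N by linarith
    show "deriv \<phi> x = 0"
      using K x N by (intro deriv_eq_0_outside[of K]) (force, linarith)
  qed
qed

lemma test_function_smooth: "\<phi> \<in> test_functions \<Longrightarrow> smooth \<phi>"
  by (simp add: test_functions_iff)

lemma test_function_deriv: "\<phi> \<in> test_functions \<Longrightarrow> deriv \<phi> \<in> test_functions"
  unfolding test_functions_iff[of "deriv \<phi>"]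
  by (meson linorder_le_cases smooth_deriv test_function_smooth test_function_support)

lemma test_function_zero: "(\<lambda>x. 0) \<in> test_functions"
  by (simp add: test_functions_iff smooth_const)

lemma test_function_mult_smooth:
  "smooth f \<Longrightarrow> \<phi> \<in> test_functions \<Longrightarrow> (\<lambda>x. f x * \<phi> x) \<in> test_functions"
  by (auto simp: test_functions_iff smooth_mult)

lemma test_function_mult:
  "\<phi> \<in> test_functions \<Longrightarrow> \<psi> \<in> test_functions \<Longrightarrow> (\<lambda>x. \<phi> x * \<psi> x) \<in> test_functions"
  by (intro test_function_mult_smooth test_function_smooth)

lemma test_function_lincomb:
  assumes "\<phi> \<in> test_functions" "\<psi> \<in> test_functions"
  shows "(\<lambda>x. a * \<phi> x + b * \<psi> x) \<in> test_functions"
proof -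
  obtain K L where "\<And>x. \<phi> x \<noteq> 0 \<Longrightarrow> \<bar>x\<bar> \<le> K" "\<And>x. \<psi> x \<noteq> 0 \<Longrightarrow> \<bar>x\<bar> \<le> L"
    using assms by (auto simp: test_functions_iff)
  then have "a * \<phi> x + b * \<psi> x \<noteq> 0 \<Longrightarrow> \<bar>x\<bar> \<le> max K L" for x
    by (smt (verit) mult_eq_0_iff)
  moreover have "smooth (\<lambda>x. a * \<phi> x + b * \<psi> x)"
    using assms by (auto simp: test_functions_iff intro!: smooth_add smooth_mult smooth_const)
  ultimately show ?thesis
    unfolding test_functions_iff by blast
qed

text \<open>The bridge between the integrals over the line that define distributions and the
  interval integrals that define primitives.\<close>

lemma lebesgue_integral_eq_integral_interval:
  fixes h :: "real \<Rightarrow> real"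
  assumes "locally_integrable h" "\<And>x. real N \<le> \<bar>x\<bar> \<Longrightarrow> h x = 0"
  shows "integrable lebesgue h" "(LINT x|lebesgue. h x) = integral {- real N..real N} h"
proof -
  have h: "(\<lambda>x. indicator {-real N..real N} x * h x) = h"
  proof
    show "indicator {-real N..real N} x * h x = h x" for x
      using assms(2)[of x] by (cases "x \<in> {-real N..real N}") auto
  qed
  have si: "set_integrable lebesgue {- real N..real N} h"
    using assms(1) by (rule locally_integrableD)
  show "integrable lebesgue h"
    using si by (simp add: set_integrable_def h)
  show "(LINT x|lebesgue. h x) = integral {- real N..real N} h"
    using set_lebesgue_integral_eq_integral(2)[OF si] by (simp add: set_lebesgue_integral_def h)
qed

lemma locally_integrable_mult_test_function:
  assumes "locally_integrable f" "\<phi> \<in> test_functions"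
  shows "locally_integrable (\<lambda>x. f x * \<phi> x)"
  using locally_integrable_mult_continuous[OF smooth_continuous[OF test_function_smooth[OF assms(2)]] assms(1)]
  by (simp add: mult.commute)

lemma integrable_mult_test_function:
  assumes "locally_integrable f" "\<phi> \<in> test_functions"
  shows "integrable lebesgue (\<lambda>x. f x * \<phi> x)"
proof -
  obtain N where "\<And>x. real N \<le> \<bar>x\<bar> \<Longrightarrow> \<phi> x = 0"
    using test_function_support[OF assms(2)] by metis
  then show ?thesis
    by (intro lebesgue_integral_eq_integral_interval[where N = N] locally_integrable_mult_test_function assms) simp
qed

text \<open>Integration by parts: the product rule gives a primitive of \<phi> f + F \<phi>', and
  the boundary terms vanish because \<phi> does.\<close>

lemma primitive_imp_weak_deriv:
  assumes F: "primitive F f" and \<phi>: "\<phi> \<in> test_functions"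
  shows "(LINT x|lebesgue. F x * deriv \<phi> x) = - (LINT x|lebesgue. f x * \<phi> x)"
proof -
  obtain N where N: "\<And>x. real N \<le> \<bar>x\<bar> \<Longrightarrow> \<phi> x = 0" "\<And>x. real N \<le> \<bar>x\<bar> \<Longrightarrow> deriv \<phi> x = 0"
    using test_function_support[OF \<phi>] by metis
  have \<phi>': "primitive \<phi> (deriv \<phi>)"
    using \<phi> by (intro primitive_of_continuous_deriv smooth_DERIV smooth_continuous smooth_deriv test_function_smooth)
  note prod = primitive_mult[OF F \<phi>']
  have "(LINT x|lebesgue. F x * deriv \<phi> x) + (LINT x|lebesgue. f x * \<phi> x)
      = (LINT x|lebesgue. F x * deriv \<phi> x + f x * \<phi> x)"
    by (intro Bochner_Integration.integral_add[symmetric] integrable_mult_test_function test_function_deriv \<phi>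
         primitiveD(1)[OF F] locally_integrable_continuous primitive_continuous[OF F])
  also have "\<dots> = (LINT x|lebesgue. \<phi> x * f x + F x * deriv \<phi> x)"
    by (simp add: algebra_simps)
  also have "\<dots> = integral {- real N..real N} (\<lambda>x. \<phi> x * f x + F x * deriv \<phi> x)"
    by (rule lebesgue_integral_eq_integral_interval[OF primitiveD(1)[OF prod]]) (simp add: N)
  also have "\<dots> = 0"
    using primitiveD(2)[OF prod, of "- real N" "real N"] N(1)[of "real N"] N(1)[of "- real N"] by simp
  finally show ?thesis by simp
qed

text \<open>The antiderivative that vanishes to the left of the support is constant to its right,
  and that constant is the total integral.\<close>

lemma test_function_antideriv:
  assumes \<psi>: "\<psi> \<in> test_functions" and zero: "(LINT x|lebesgue. \<psi> x) = 0"
  obtains \<phi> where "\<phi> \<in> test_functions" "deriv \<phi> = \<psi>"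
proof -
  obtain N where N: "\<And>x. real N \<le> \<bar>x\<bar> \<Longrightarrow> \<psi> x = 0"
    using test_function_support[OF \<psi>] by metis
  have cont: "continuous_on UNIV \<psi>"
    using \<psi> smooth_continuous test_function_smooth by blast
  obtain F where F: "primitive F \<psi>"
    using primitive_exists[OF locally_integrable_continuous[OF cont]] by metis
  let ?\<phi> = "\<lambda>x. F x - F (- real N)"
  have deriv: "(?\<phi> has_real_derivative \<psi> x) (at x)" for x
    using primitive_imp_deriv[OF F cont] by (auto intro!: derivative_eq_intros)
  have "F (real N) - F (- real N) = integral {- real N..real N} \<psi>"
    by (subst primitiveD(2)[OF F]) auto
  also have "\<dots> = 0"
    using lebesgue_integral_eq_integral_interval[OF primitiveD(1)[OF F] N] zero by simp
  finally have ends: "F (real N) = F (- real N)" by simp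
  have flat: "F a = F b" if "a \<le> b" "\<And>x. x \<in> {a..b} \<Longrightarrow> real N \<le> \<bar>x\<bar>" for a b
  proof -
    have "integral {a..b} \<psi> = integral {a..b} (\<lambda>x. 0)"
      by (rule integral_cong) (use that N in auto)
    then show ?thesis
      using primitiveD(2)[OF F that(1)] by simp
  qed
  have "?\<phi> x = 0" if "\<not> \<bar>x\<bar> \<le> real N" for x
    using that flat[of x "- real N"] flat[of "real N" x] ends by (cases "x \<le> 0") auto
  then have "?\<phi> \<in> test_functions"
    using smooth_antideriv[OF deriv test_function_smooth[OF \<psi>]] by (auto simp: test_functions_iff)
  moreover have "deriv ?\<phi> = \<psi>"
    using deriv by (intro ext DERIV_imp_deriv)
  ultimately show thesis by (rule that)
qed

section \<open>Bump functions, the fundamental lemma of the calculus of variations and the du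
  Bois-Reymond lemma\<close>

text \<open>Scaling by \<open>Suc n\<close> drives each flat exponential to 1 wherever its argument
  is positive. The bumps therefore tend pointwise to the indicator of the open interval and stay
  below it.\<close>

definition bump :: "real \<Rightarrow> real \<Rightarrow> nat \<Rightarrow> real \<Rightarrow> real" where
  "bump a b n x = flat_exp (real (Suc n) * (x - a)) * flat_exp (real (Suc n) * (b - x))"

lemma flat_exp_bounds: "0 \<le> flat_exp x" "flat_exp x \<le> 1"
  by (auto simp: flat_exp_def)

lemma bump_bounds: "0 \<le> bump a b n x" "bump a b n x \<le> 1"
  using flat_exp_bounds by (auto simp: bump_def intro: mult_le_one)

lemma bump_eq_0: "x \<notin> {a<..<b} \<Longrightarrow> bump a b n x = 0"
  by (auto simp: bump_def flat_exp_def zero_less_mult_iff)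

lemma bump_test_function: "bump a b n \<in> test_functions"
proof -
  have "smooth (\<lambda>x. flat_exp (real (Suc n) * x + - real (Suc n) * a) * flat_exp (- real (Suc n) * x + real (Suc n) * b))"
    by (intro smooth_mult smooth_affine smooth_flat_exp)
  then have "smooth (bump a b n)"
    by (simp add: bump_def[abs_def] algebra_simps)
  moreover have "\<bar>x\<bar> \<le> max \<bar>a\<bar> \<bar>b\<bar>" if "bump a b n x \<noteq> 0" for x
  proof -
    have "a < x" "x < b"
      using bump_eq_0[of x a b n] that by auto
    then show ?thesis by linarith
  qed
  ultimately show ?thesis
    unfolding test_functions_iff by blast
qed

lemma flat_exp_scaled_tendsto:
  assumes "y > 0"
  shows "(\<lambda>n. flat_exp (real (Suc n) * y)) \<longlonglongrightarrow> 1"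
proof -
  have "(\<lambda>n. exp (- (inverse (real (Suc n)) * (1 / y)))) \<longlonglongrightarrow> exp (- (0 * (1 / y)))"
    by (intro tendsto_intros LIMSEQ_inverse_real_of_nat)
  then show ?thesis
    using assms by (simp add: flat_exp_def divide_inverse del: of_nat_Suc)
qed

lemma bump_tendsto: "(\<lambda>n. bump a b n x) \<longlonglongrightarrow> indicator {a<..<b} x"
proof (cases "x \<in> {a<..<b}")
  case True
  then have "(\<lambda>n. bump a b n x) \<longlonglongrightarrow> 1 * 1"
    unfolding bump_def by (intro tendsto_mult flat_exp_scaled_tendsto) auto
  then show ?thesis using True by simp
qed (simp add: bump_eq_0)

lemma locally_integrable_measurable:
  assumes "locally_integrable f"
  shows "f \<in> borel_measurable lebesgue"
proof (rule borel_measurable_LIMSEQ_real)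
  show "(\<lambda>x. indicator {-real n..real n} x * f x) \<in> borel_measurable lebesgue" for n
    using locally_integrableD[OF assms, of "- real n" "real n"]
    by (simp add: set_integrable_def)
  fix x
  obtain N where "\<bar>x\<bar> \<le> real N" using real_arch_simple by blast
  then have "\<forall>\<^sub>F n in sequentially. f x = indicator {-real n..real n} x * f x"
    by (intro eventually_sequentiallyI[of N]) (auto simp: indicator_def)
  then show "(\<lambda>n. indicator {-real n..real n} x * f x) \<longlonglongrightarrow> f x"
    by (rule Lim_transform_eventually[OF tendsto_const])
qed

text \<open>Dominated convergence along the bumps turns the hypothesis into vanishing integrals of
  \<open>h\<close> over all intervals.\<close>

lemma AE_zero_of_test_functions:
  assumes li: "locally_integrable h"
    and zero: "\<And>\<psi>. \<psi> \<in> test_functions \<Longrightarrow> (LINT x|lebesgue. h x * \<psi> x) = 0"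
  shows "AE x in lebesgue. h x = 0"
proof (rule AE_zero_of_interval_integrals[OF li])
  fix a b :: real
  have si: "set_integrable lebesgue {a<..<b} h"
    using locally_integrableD[OF li, of a b] by (rule set_integrable_subset) auto
  have "(\<lambda>n. LINT x|lebesgue. h x * bump a b n x) \<longlonglongrightarrow> (LINT x|lebesgue. h x * indicator {a<..<b} x)"
  proof (rule integral_dominated_convergence)
    show "integrable lebesgue (\<lambda>x. \<bar>indicator {a<..<b} x * h x\<bar>)"
      using si by (auto simp: set_integrable_def intro!: integrable_abs)
    show "AE x in lebesgue. (\<lambda>n. h x * bump a b n x) \<longlonglongrightarrow> h x * indicator {a<..<b} x"
      by (intro AE_I2 tendsto_mult tendsto_const bump_tendsto)
    show "(\<lambda>x. h x * indicator {a<..<b} x) \<in> borel_measurable lebesgue"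
      by (intro borel_measurable_times locally_integrable_measurable[OF li] borel_measurable_indicator) auto
    show "(\<lambda>x. h x * bump a b n x) \<in> borel_measurable lebesgue" for n
      by (intro borel_measurable_times test_function_measurable bump_test_function
            locally_integrable_measurable[OF li])
    have "\<bar>h x * bump a b n x\<bar> \<le> \<bar>indicator {a<..<b} x * h x\<bar>" for x n
      using mult_left_mono[OF bump_bounds(2)[of a b n x], of "\<bar>h x\<bar>"]
      by (auto simp: abs_mult bump_bounds bump_eq_0 indicator_def)
    then show "AE x in lebesgue. norm (h x * bump a b n x) \<le> \<bar>indicator {a<..<b} x * h x\<bar>" for n
      by simp
  qed
  then have "(LINT x:{a<..<b}|lebesgue. h x) = 0"
    using zero[OF bump_test_function] by (simp add: set_lebesgue_integral_def mult.commute LIMSEQ_const_iff)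
  then show "integral {a..b} h = 0"
    using set_lebesgue_integral_eq_integral(2)[OF si] by (simp add: integral_open_interval_real)
qed

text \<open>A test function with integral zero is the derivative of a test function, so
  \<open>h\<close> annihilates it. Any other one is brought into this form by subtracting a multiple
  of a fixed bump, and the value of \<open>h\<close> on that bump determines the constant.\<close>

lemma AE_const_of_weak_deriv_zero:
  assumes li: "locally_integrable h"
    and zero: "\<And>\<phi>. \<phi> \<in> test_functions \<Longrightarrow> (LINT x|lebesgue. h x * deriv \<phi> x) = 0"
  obtains c where "AE x in lebesgue. h x = c"
proof -
  let ?\<rho> = "bump 0 1 0"
  define m where "m = (LINT x|lebesgue. ?\<rho> x)"
  have intg: "integrable lebesgue (\<lambda>x. f x * \<psi> x)" if "locally_integrable f" "\<psi> \<in> test_functions" for f \<psi>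
    using integrable_mult_test_function that .
  have one: "locally_integrable (\<lambda>x. 1)"
    by (intro locally_integrable_continuous continuous_intros)
  note intg1 = intg[OF one, simplified]
  have "m \<noteq> 0"
  proof
    assume "m = 0"
    then have "AE x in lebesgue. ?\<rho> x = 0"
      unfolding m_def
      by (subst (asm) integral_nonneg_eq_0_iff_AE) (auto simp: bump_bounds intg1 bump_test_function)
    then have "AE x in lebesgue. x \<notin> {0<..<1::real}"
      by eventually_elim (auto simp: bump_def flat_exp_def)
    then have "{0<..<1::real} \<in> null_sets lebesgue"
      by (subst AE_iff_null_sets) auto
    then show False by (auto simp: null_sets_def)
  qed
  define c where "c = (LINT x|lebesgue. h x * ?\<rho> x) / m"
  have "AE x in lebesgue. h x - c = 0"
  proof (rule AE_zero_of_test_functions)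
    show "locally_integrable (\<lambda>x. h x - c)"
      by (intro locally_integrable_diff li locally_integrable_continuous continuous_intros)
    fix \<psi> assume \<psi>: "\<psi> \<in> test_functions"
    define s where "s = (LINT x|lebesgue. \<psi> x)"
    \<comment> \<open>The coefficient is chosen to make the integral s - (s/m) m vanish.\<close>
    let ?\<chi> = "\<lambda>x. 1 * \<psi> x + (- s / m) * ?\<rho> x"
    have "?\<chi> \<in> test_functions"
      by (intro test_function_lincomb \<psi> bump_test_function)
    moreover have "(LINT x|lebesgue. ?\<chi> x) = s + (- s / m) * m"
      unfolding s_def m_def
      by (subst Bochner_Integration.integral_add) (auto simp: intg1 \<psi> bump_test_function)
    ultimately obtain \<phi> where \<phi>: "\<phi> \<in> test_functions" "deriv \<phi> = ?\<chi>"
      using \<open>m \<noteq> 0\<close> by (metis (no_types, lifting) add.right_inverse nonzero_eq_divide_eq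
          minus_divide_left test_function_antideriv)
    have "0 = (LINT x|lebesgue. h x * ?\<chi> x)"
      using zero[OF \<phi>(1)] \<phi>(2) by simp
    also have "\<dots> = (LINT x|lebesgue. h x * \<psi> x + (- s / m) * (h x * ?\<rho> x))"
      by (simp add: algebra_simps)
    also have "\<dots> = (LINT x|lebesgue. h x * \<psi> x) + (- s / m) * (LINT x|lebesgue. h x * ?\<rho> x)"
      by (subst Bochner_Integration.integral_add) (auto simp: intg li \<psi> bump_test_function)
    also have "\<dots> = (LINT x|lebesgue. h x * \<psi> x) - c * s"
      by (simp add: c_def)
    also have "\<dots> = (LINT x|lebesgue. h x * \<psi> x) - (LINT x|lebesgue. c * \<psi> x)"
      by (simp add: s_def)
    also have "\<dots> = (LINT x|lebesgue. h x * \<psi> x - c * \<psi> x)"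
      by (intro Bochner_Integration.integral_diff[symmetric] integrable_mult_right intg li \<psi> intg1)
    finally show "(LINT x|lebesgue. (h x - c) * \<psi> x) = 0"
      by (simp add: algebra_simps)
  qed
  then show thesis
    by (intro that[of c]) (auto elim: eventually_mono)
qed

text \<open>Subtracting any primitive of \<open>g\<close> from \<open>f\<close> leaves a function
  with zero weak derivative, hence a constant almost everywhere. This yields the continuous
  representative of the difference of two preimages.\<close>

lemma weak_deriv_imp_primitive:
  assumes f: "locally_integrable f" and g: "locally_integrable g"
    and weak: "\<And>\<phi>. \<phi> \<in> test_functions \<Longrightarrow>
                 (LINT x|lebesgue. f x * deriv \<phi> x) = - (LINT x|lebesgue. g x * \<phi> x)"
  obtains F where "primitive F g" "AE x in lebesgue. f x = F x"
proof -
  obtain G where G: "primitive G g"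
    using primitive_exists[OF g] by metis
  have liG: "locally_integrable G"
    by (intro locally_integrable_continuous primitive_continuous[OF G])
  have "(LINT x|lebesgue. (f x - G x) * deriv \<phi> x) = 0" if \<phi>: "\<phi> \<in> test_functions" for \<phi>
  proof -
    have "(LINT x|lebesgue. (f x - G x) * deriv \<phi> x)
        = (LINT x|lebesgue. f x * deriv \<phi> x - G x * deriv \<phi> x)"
      by (simp add: algebra_simps)
    also have "\<dots> = (LINT x|lebesgue. f x * deriv \<phi> x) - (LINT x|lebesgue. G x * deriv \<phi> x)"
      by (intro Bochner_Integration.integral_diff integrable_mult_test_function f liG test_function_deriv \<phi>)
    finally show ?thesis
      using weak[OF \<phi>] primitive_imp_weak_deriv[OF G \<phi>] by simp
  qed
  then obtain c where c: "AE x in lebesgue. f x - G x = c"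
    using AE_const_of_weak_deriv_zero[OF locally_integrable_diff[OF f liG]] by metis
  show thesis
  proof
    show "primitive (\<lambda>x. G x + c) g"
      using G by (simp add: primitive_def)
    show "AE x in lebesgue. f x = G x + c"
      using c by eventually_elim simp
  qed
qed

section \<open>The Miura map takes values in the local Sobolev space\<close>

lemma L2_loc_locally_integrable:
  assumes "r \<in> L2_loc_functions"
  shows "locally_integrable (\<lambda>x. (r x)\<^sup>2)" "locally_integrable r"
proof -
  have r[measurable]: "r \<in> borel_measurable lebesgue"
    using assms by (simp add: L2_loc_functions_def)
  show sq: "locally_integrable (\<lambda>x. (r x)\<^sup>2)"
    using assms by (auto simp: L2_loc_functions_def locally_integrable_def)
  have "r absolutely_integrable_on {a..b}" for a b
  proof (rule measurable_bounded_by_integrable_imp_absolutely_integrable)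
    show "r \<in> borel_measurable (lebesgue_on {a..b})"
      using r by (rule measurable_restrict_space1)
    show "(\<lambda>x. 1 + (r x)\<^sup>2) integrable_on {a..b}"
      by (intro locally_integrable_imp_integrable_on locally_integrable_add sq
            locally_integrable_continuous continuous_intros)
    have "\<bar>t\<bar> \<le> 1 + t\<^sup>2" for t :: real
      using zero_le_power2[of "\<bar>t\<bar> - 1"] abs_ge_zero[of t] by (simp add: power2_eq_square algebra_simps)
    then show "norm (r x) \<le> 1 + (r x)\<^sup>2" for x by simp
  qed simp
  then show "locally_integrable r"
    by (simp add: locally_integrable_def)
qed

lemma L2_loc_functionsI:
  assumes "r \<in> borel_measurable lebesgue" "locally_integrable (\<lambda>x. (r x)\<^sup>2)"
  shows "r \<in> L2_loc_functions"
proof -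
  have "set_integrable lebesgue K (\<lambda>x. (r x)\<^sup>2)" if K: "compact K" for K
  proof -
    obtain b where "\<And>x. x \<in> K \<Longrightarrow> \<bar>x\<bar> \<le> b"
      using compact_imp_bounded[OF K] by (auto simp: bounded_iff)
    then have sub: "K \<subseteq> {- b..b}"
      by (force simp: abs_le_iff)
    show ?thesis
      by (rule set_integrable_subset[OF locally_integrableD[OF assms(2)] _ sub])
         (simp add: K borel_compact)
  qed
  then show ?thesis
    using assms by (simp add: L2_loc_functions_def)
qed

lemma L2_loc_functions_continuous:
  assumes "continuous_on UNIV f"
  shows "f \<in> L2_loc_functions"
proof (rule L2_loc_functionsI)
  show "f \<in> borel_measurable lebesgue"
    using assms locally_integrable_continuous locally_integrable_measurable by blast
  show "locally_integrable (\<lambda>x. (f x)\<^sup>2)"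
    by (intro locally_integrable_continuous continuous_intros assms)
qed

lemma L2_loc_functions_add:
  assumes r: "r \<in> L2_loc_functions" and s: "s \<in> L2_loc_functions"
  shows "(\<lambda>x. r x + s x) \<in> L2_loc_functions"
proof (rule L2_loc_functionsI)
  have m[measurable]: "r \<in> borel_measurable lebesgue" "s \<in> borel_measurable lebesgue"
    using r s by (simp_all add: L2_loc_functions_def)
  show m2[measurable]: "(\<lambda>x. r x + s x) \<in> borel_measurable lebesgue"
    by (intro borel_measurable_add m)
  have "(\<lambda>x. (r x + s x)\<^sup>2) absolutely_integrable_on {a..b}" for a b
  proof (rule measurable_bounded_by_integrable_imp_absolutely_integrable)
    show "(\<lambda>x. (r x + s x)\<^sup>2) \<in> borel_measurable (lebesgue_on {a..b})"
      by (intro measurable_restrict_space1 borel_measurable_power m2)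
    have "continuous_on UNIV (\<lambda>x::real. 2::real)" by simp
    then show "(\<lambda>x. 2 * (r x)\<^sup>2 + 2 * (s x)\<^sup>2) integrable_on {a..b}"
      by (intro locally_integrable_imp_integrable_on locally_integrable_add
            locally_integrable_mult_continuous L2_loc_locally_integrable r s)
    have "(x + y)\<^sup>2 \<le> 2 * x\<^sup>2 + 2 * y\<^sup>2" for x y :: real
      using zero_le_power2[of "x - y"] by (simp add: power2_eq_square algebra_simps)
    then show "norm ((r x + s x)\<^sup>2) \<le> 2 * (r x)\<^sup>2 + 2 * (s x)\<^sup>2" for x by simp
  qed simp
  then show "locally_integrable (\<lambda>x. (r x + s x)\<^sup>2)"
    by (simp add: locally_integrable_def)
qed

section \<open>Distributions of first order\<close>

text \<open>The distribution b - a'. Images under the Miura map have this form with a = -r and b =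
  r^2, and the form survives multiplication by a test function.\<close>

definition first_order :: "(real \<Rightarrow> real) \<Rightarrow> (real \<Rightarrow> real) \<Rightarrow> functional" where
  "first_order a b = (\<lambda>\<phi>\<in>test_functions. (LINT x|lebesgue. a x * deriv \<phi> x) + (LINT x|lebesgue. b x * \<phi> x))"

lemma test_function_continuous: "\<phi> \<in> test_functions \<Longrightarrow> continuous_on UNIV \<phi>"
  by (intro smooth_continuous test_function_smooth)

lemma deriv_lincomb:
  assumes "\<phi> \<in> test_functions" "\<psi> \<in> test_functions"
  shows "deriv (\<lambda>x. a * \<phi> x + b * \<psi> x) = (\<lambda>x. a * deriv \<phi> x + b * deriv \<psi> x)"
  using assms by (intro ext DERIV_imp_deriv)
    (auto intro!: derivative_eq_intros smooth_DERIV test_function_smooth)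

lemma deriv_mult_test_functions:
  assumes "\<phi> \<in> test_functions" "\<psi> \<in> test_functions"
  shows "deriv (\<lambda>x. \<phi> x * \<psi> x) = (\<lambda>x. \<phi> x * deriv \<psi> x + deriv \<phi> x * \<psi> x)"
  using DERIV_mult'[OF smooth_DERIV[OF test_function_smooth[OF assms(1)]]
      smooth_DERIV[OF test_function_smooth[OF assms(2)]]]
  by (intro ext DERIV_imp_deriv)

lemma test_function_bdd_above:
  assumes "\<phi> \<in> test_functions"
  shows "bdd_above (range (\<lambda>x. \<bar>\<phi> x\<bar>))"
proof -
  obtain N where N: "\<And>x. real N \<le> \<bar>x\<bar> \<Longrightarrow> \<phi> x = 0"
    using test_function_support[OF assms] by metis
  have "compact (\<phi> ` {- real N..real N})"
    using test_function_continuous[OF assms] by (intro compact_continuous_image) (auto intro: continuous_on_subset)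
  then obtain B where B: "\<And>x. x \<in> {- real N..real N} \<Longrightarrow> \<bar>\<phi> x\<bar> \<le> B"
    using compact_imp_bounded by (force simp: bounded_iff)
  have "\<bar>\<phi> x\<bar> \<le> max B 0" for x
  proof (cases "real N \<le> \<bar>x\<bar>")
    case False
    then have "x \<in> {- real N..real N}"
      unfolding atLeastAtMost_iff by linarith
    then show ?thesis using B[of x] by (intro max.coboundedI1)
  qed (simp add: N)
  then show ?thesis
    by (auto intro!: bdd_aboveI[of _ "max B 0"])
qed

lemma abs_integral_mult_test_function_le:
  assumes "locally_integrable f" "\<phi> \<in> test_functions"
    and N: "\<And>x. real N \<le> \<bar>x\<bar> \<Longrightarrow> f x * \<phi> x = 0" and S: "\<And>x. \<bar>\<phi> x\<bar> \<le> S"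
  shows "\<bar>LINT x|lebesgue. f x * \<phi> x\<bar> \<le> S * integral {- real N..real N} (\<lambda>x. \<bar>f x\<bar>)"
proof -
  have li: "locally_integrable (\<lambda>x. \<phi> x * f x)"
    using locally_integrable_mult_test_function[OF assms(1,2)] by (simp add: mult.commute)
  have "(LINT x|lebesgue. f x * \<phi> x) = (LINT x|lebesgue. \<phi> x * f x)"
    by (simp add: mult.commute)
  also have "\<dots> = integral {- real N..real N} (\<lambda>x. \<phi> x * f x)"
    by (rule lebesgue_integral_eq_integral_interval[OF li]) (use N in \<open>simp add: mult.commute\<close>)
  also have "\<bar>\<dots>\<bar> \<le> S * integral {- real N..real N} (\<lambda>x. \<bar>f x\<bar>)"
    by (rule abs_integral_mult_le[OF assms(1) li S])
  finally show ?thesis .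
qed

lemma first_order_distribution:
  assumes a: "locally_integrable a" and b: "locally_integrable b"
  shows "first_order a b \<in> distributions"
  unfolding distributions_def
proof (intro CollectI conjI ballI allI impI)
  show "first_order a b \<in> extensional test_functions"
    by (simp add: first_order_def)
next
  fix \<phi> \<psi> and c d :: real assume t: "\<phi> \<in> test_functions" "\<psi> \<in> test_functions"
  have split: "(LINT x|lebesgue. f x * (c * p x + d * q x))
      = c * (LINT x|lebesgue. f x * p x) + d * (LINT x|lebesgue. f x * q x)"
    if "locally_integrable f" "p \<in> test_functions" "q \<in> test_functions" for f p q
  proof -
    have "(LINT x|lebesgue. f x * (c * p x + d * q x))
        = (LINT x|lebesgue. c * (f x * p x) + d * (f x * q x))"
      by (simp add: algebra_simps)
    also have "\<dots> = c * (LINT x|lebesgue. f x * p x) + d * (LINT x|lebesgue. f x * q x)"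
      by (subst Bochner_Integration.integral_add)
         (simp_all add: integrable_mult_test_function that)
    finally show ?thesis .
  qed
  show "first_order a b (\<lambda>x. c * \<phi> x + d * \<psi> x) = c * first_order a b \<phi> + d * first_order a b \<psi>"
    by (simp add: first_order_def test_function_lincomb t deriv_lincomb split a b test_function_deriv)
       (simp add: algebra_simps)
next
  fix K :: "real set" assume "compact K"
  then obtain k where k: "\<And>x. x \<in> K \<Longrightarrow> \<bar>x\<bar> \<le> k"
    using compact_imp_bounded by (force simp: bounded_iff)
  obtain N :: nat where N: "k < real N"
    using reals_Archimedean2 by blast
  define A B where "A = integral {- real N..real N} (\<lambda>x. \<bar>a x\<bar>)"
    and "B = integral {- real N..real N} (\<lambda>x. \<bar>b x\<bar>)"
  have AB: "A \<ge> 0" "B \<ge> 0"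
    unfolding A_def B_def using a b
    by (auto intro!: Henstock_Kurzweil_Integration.integral_nonneg locally_integrable_imp_integrable_on locally_integrable_abs)
  show "\<exists>C M. \<forall>\<phi>\<in>test_functions. {x. \<phi> x \<noteq> 0} \<subseteq> K \<longrightarrow>
          \<bar>first_order a b \<phi>\<bar> \<le> C * (\<Sum>j\<le>M. SUP x. \<bar>(deriv ^^ j) \<phi> x\<bar>)"
  proof (intro exI[of _ "A + B"] exI[of _ 1] ballI impI)
    fix \<phi> assume \<phi>: "\<phi> \<in> test_functions" and supp: "{x. \<phi> x \<noteq> 0} \<subseteq> K"
    then have z: "\<phi> x = 0" if "k < \<bar>x\<bar>" for x
      using k[of x] that by force
    have z': "deriv \<phi> x = 0" if "k < \<bar>x\<bar>" for x
      using z that by (rule deriv_eq_0_outside)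
    define S S' where "S = (SUP x. \<bar>\<phi> x\<bar>)" and "S' = (SUP x. \<bar>deriv \<phi> x\<bar>)"
    have S: "\<bar>\<phi> x\<bar> \<le> S" and S': "\<bar>deriv \<phi> x\<bar> \<le> S'" for x
      unfolding S_def S'_def using \<phi> test_function_deriv[OF \<phi>]
      by (auto intro!: cSUP_upper test_function_bdd_above)
    have "\<bar>LINT x|lebesgue. a x * deriv \<phi> x\<bar> \<le> S' * A"
      unfolding A_def using N by (intro abs_integral_mult_test_function_le a test_function_deriv \<phi> S') (simp add: z')
    moreover have "\<bar>LINT x|lebesgue. b x * \<phi> x\<bar> \<le> S * B"
      unfolding B_def using N by (intro abs_integral_mult_test_function_le b \<phi> S) (simp add: z)
    moreover have "S' * A + S * B \<le> (A + B) * (S + S')"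
      using mult_nonneg_nonneg[OF AB(1), of S] mult_nonneg_nonneg[OF AB(2), of S'] S[of 0] S'[of 0]
      by (simp add: algebra_simps)
    ultimately show "\<bar>first_order a b \<phi>\<bar> \<le> (A + B) * (\<Sum>j\<le>1. SUP x. \<bar>(deriv ^^ j) \<phi> x\<bar>)"
      using \<phi> by (simp add: first_order_def S_def S'_def)
  qed
qed

text \<open>By the product rule for \<eta> \<phi>, the part of \<open>a\<close> that meets \<eta>'
  passes into the zero-order coefficient.\<close>

lemma dist_mult_first_order:
  assumes a: "locally_integrable a" and b: "locally_integrable b" and \<eta>: "\<eta> \<in> test_functions"
  shows "dist_mult \<eta> (first_order a b) =
    first_order (\<lambda>x. a x * \<eta> x) (\<lambda>x. a x * deriv \<eta> x + b x * \<eta> x)"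
proof
  fix \<phi> :: "real \<Rightarrow> real"
  show "dist_mult \<eta> (first_order a b) \<phi> =
    first_order (\<lambda>x. a x * \<eta> x) (\<lambda>x. a x * deriv \<eta> x + b x * \<eta> x) \<phi>"
  proof (cases "\<phi> \<in> test_functions")
    case True
    note intg = integrable_mult_test_function[OF locally_integrable_mult_test_function]
    have i1: "integrable lebesgue (\<lambda>x. a x * \<eta> x * deriv \<phi> x)"
     and i2: "integrable lebesgue (\<lambda>x. a x * deriv \<eta> x * \<phi> x)"
     and i3: "integrable lebesgue (\<lambda>x. b x * \<eta> x * \<phi> x)"
      by (intro intg a b \<eta> True test_function_deriv)+
    have "dist_mult \<eta> (first_order a b) \<phi> =
        (LINT x|lebesgue. a x * \<eta> x * deriv \<phi> x + a x * deriv \<eta> x * \<phi> x) + (LINT x|lebesgue. b x * \<eta> x * \<phi> x)"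
      by (simp add: dist_mult_def first_order_def True \<eta> test_function_mult deriv_mult_test_functions algebra_simps)
    also have "\<dots> = (LINT x|lebesgue. a x * \<eta> x * deriv \<phi> x) +
        (LINT x|lebesgue. a x * deriv \<eta> x * \<phi> x + b x * \<eta> x * \<phi> x)"
      using i1 i2 i3 by simp
    also have "\<dots> = first_order (\<lambda>x. a x * \<eta> x) (\<lambda>x. a x * deriv \<eta> x + b x * \<eta> x) \<phi>"
      by (simp add: first_order_def True algebra_simps)
    finally show ?thesis .
  qed (simp add: dist_mult_def first_order_def)
qed

lemma H1_norm_nonneg: "H1_norm \<phi> \<ge> 0"
  by (simp add: H1_norm_def)

lemma H1_norm_square:
  assumes \<phi>: "\<phi> \<in> test_functions"
    and N: "\<And>x. real N \<le> \<bar>x\<bar> \<Longrightarrow> \<phi> x = 0 \<and> deriv \<phi> x = 0"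
  shows "(H1_norm \<phi>)\<^sup>2 = integral {- real N..real N} (\<lambda>x. (\<phi> x)\<^sup>2 + (deriv \<phi> x)\<^sup>2)"
proof -
  have "locally_integrable (\<lambda>x. (\<phi> x)\<^sup>2 + (deriv \<phi> x)\<^sup>2)"
    by (intro locally_integrable_continuous continuous_intros test_function_continuous test_function_deriv \<phi>)
  from lebesgue_integral_eq_integral_interval(2)[OF this, of N] N
  have "(LINT x|lebesgue. (\<phi> x)\<^sup>2 + (deriv \<phi> x)\<^sup>2)
      = integral {- real N..real N} (\<lambda>x. (\<phi> x)\<^sup>2 + (deriv \<phi> x)\<^sup>2)"
    by simp
  moreover have "0 \<le> (LINT x|lebesgue. (\<phi> x)\<^sup>2 + (deriv \<phi> x)\<^sup>2)"
    by (intro Bochner_Integration.integral_nonneg) simp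
  ultimately show ?thesis
    by (simp add: H1_norm_def)
qed

text \<open>The Sobolev bound in dimension one: \<open>\<phi>\<^sup>2\<close> is the integral of \<open>2 \<phi> \<phi>'\<close>.\<close>

lemma abs_le_H1_norm:
  assumes \<phi>: "\<phi> \<in> test_functions"
  shows "\<bar>\<phi> x\<bar> \<le> H1_norm \<phi>"
proof -
  obtain N where N: "\<And>x. real N \<le> \<bar>x\<bar> \<Longrightarrow> \<phi> x = 0 \<and> deriv \<phi> x = 0"
    using test_function_support[OF \<phi>] by metis
  show ?thesis
  proof (cases "real N \<le> \<bar>x\<bar>")
    case True
    then show ?thesis using N H1_norm_nonneg by simp
  next
    case False
    let ?g = "\<lambda>x. (\<phi> x)\<^sup>2 + (deriv \<phi> x)\<^sup>2"
    have cont: "continuous_on UNIV \<phi>" "continuous_on UNIV (deriv \<phi>)"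
      using \<phi> test_function_continuous test_function_deriv by auto
    have P: "primitive \<phi> (deriv \<phi>)"
      using \<phi> by (intro primitive_of_continuous_deriv smooth_DERIV cont test_function_smooth)
    have li: "locally_integrable ?g"
      by (intro locally_integrable_continuous continuous_intros cont)
    have "(\<phi> x)\<^sup>2 = integral {- real N..x} (\<lambda>x. \<phi> x * deriv \<phi> x + \<phi> x * deriv \<phi> x)"
      using False N[of "- real N"] by (subst primitiveD(2)[OF primitive_mult[OF P P]]) (auto simp: power2_eq_square)
    also have "\<dots> \<le> integral {- real N..x} ?g"
    proof (rule Henstock_Kurzweil_Integration.integral_le)
      show "\<phi> x * deriv \<phi> x + \<phi> x * deriv \<phi> x \<le> ?g x" for x
        using zero_le_power2[of "\<phi> x - deriv \<phi> x"] by (simp add: power2_eq_square algebra_simps)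
    qed (intro locally_integrable_imp_integrable_on primitiveD(1)[OF primitive_mult[OF P P]] li)+
    also have "\<dots> \<le> integral {- real N..real N} ?g"
      using False by (intro integral_subset_le locally_integrable_imp_integrable_on li) auto
    also have "\<dots> = (H1_norm \<phi>)\<^sup>2"
      using H1_norm_square[OF \<phi> N] by simp
    finally show ?thesis
      by (simp add: abs_le_square_iff[symmetric] H1_norm_nonneg)
  qed
qed

text \<open>The coefficient \<open>a\<close> is square integrable and pairs with the derivative of
  \<phi> in the L^2 sense; \<open>b\<close> is only integrable and pairs with \<phi> through the
  supremum bound \<open>abs_le_H1_norm\<close>.\<close>

lemma first_order_Hm1:
  assumes a: "locally_integrable a" and b: "locally_integrable b" and a2: "locally_integrable (\<lambda>x. (a x)\<^sup>2)"
    and N: "\<And>x. real N \<le> \<bar>x\<bar> \<Longrightarrow> a x = 0 \<and> b x = 0"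
  shows "first_order a b \<in> Hm1"
proof -
  define A B where "A = (LINT x|lebesgue. (a x)\<^sup>2)"
    and "B = integral {- real N..real N} (\<lambda>x. \<bar>b x\<bar>)"
  have inta: "integrable lebesgue (\<lambda>x. (a x)\<^sup>2)"
    by (rule lebesgue_integral_eq_integral_interval[OF a2]) (use N in auto)
  have "\<bar>first_order a b \<phi>\<bar> \<le> ((A + 1) / 2 + B) * H1_norm \<phi>" if \<phi>: "\<phi> \<in> test_functions" for \<phi>
  proof -
    define h where "h = H1_norm \<phi>"
    have h: "\<bar>\<phi> x\<bar> \<le> h" for x
      unfolding h_def by (rule abs_le_H1_norm[OF \<phi>])
    have intd: "integrable lebesgue (\<lambda>x. (deriv \<phi> x)\<^sup>2)" "integrable lebesgue (\<lambda>x. (\<phi> x)\<^sup>2)"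
      using integrable_mult_test_function[OF locally_integrable_continuous[OF test_function_continuous]]
        \<phi> test_function_deriv[OF \<phi>] by (auto simp: power2_eq_square)
    have "(LINT x|lebesgue. (deriv \<phi> x)\<^sup>2) \<le> (LINT x|lebesgue. (\<phi> x)\<^sup>2 + (deriv \<phi> x)\<^sup>2)"
      using intd by (intro integral_mono) auto
    then have d: "(LINT x|lebesgue. (deriv \<phi> x)\<^sup>2) \<le> h\<^sup>2"
      by (simp add: h_def H1_norm_def integral_nonneg_AE)
    have "\<bar>LINT x|lebesgue. a x * deriv \<phi> x\<bar> \<le> (A + 1) / 2 * h"
    proof (cases "h = 0")
      case True
      then have "\<phi> = (\<lambda>x. 0)"
        using h by auto
      then show ?thesis using True by simp
    next
      case False
      then have "h > 0" using h[of 0] by linarith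
      \<comment> \<open>Young's inequality with weight \<open>h\<close>, the norm of \<phi>, makes
        both resulting terms linear in \<open>h\<close>. It divides by \<open>h\<close>, which is
        why norm zero was split off.\<close>
      have "\<bar>a x * deriv \<phi> x\<bar> \<le> h / 2 * (a x)\<^sup>2 + 1 / (2 * h) * (deriv \<phi> x)\<^sup>2" for x
      proof -
        have "2 * h * (\<bar>a x\<bar> * \<bar>deriv \<phi> x\<bar>) \<le> (h * a x)\<^sup>2 + (deriv \<phi> x)\<^sup>2"
          using zero_le_power2[of "h * \<bar>a x\<bar> - \<bar>deriv \<phi> x\<bar>"]
          by (simp add: power2_eq_square algebra_simps)
        then show ?thesis
          using \<open>h > 0\<close> by (simp add: abs_mult field_simps power2_eq_square)
      qed
      then have "\<bar>LINT x|lebesgue. a x * deriv \<phi> x\<bar> \<le>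
          (LINT x|lebesgue. h / 2 * (a x)\<^sup>2 + 1 / (2 * h) * (deriv \<phi> x)\<^sup>2)"
        using inta intd integrable_mult_test_function[OF a test_function_deriv[OF \<phi>]]
        by (intro order_trans[OF integral_abs_bound] integral_mono) auto
      also have "\<dots> = h / 2 * A + 1 / (2 * h) * (LINT x|lebesgue. (deriv \<phi> x)\<^sup>2)"
        using inta intd by (simp add: A_def)
      also have "\<dots> \<le> h / 2 * A + 1 / (2 * h) * h\<^sup>2"
        using d \<open>h > 0\<close> by (intro add_left_mono mult_left_mono) auto
      also have "\<dots> = (A + 1) / 2 * h"
        using \<open>h > 0\<close> by (simp add: field_simps power2_eq_square)
      finally show ?thesis .
    qed
    moreover have "\<bar>LINT x|lebesgue. b x * \<phi> x\<bar> \<le> h * B"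
      unfolding B_def by (rule abs_integral_mult_test_function_le[OF b \<phi>]) (use N h in auto)
    ultimately have "\<bar>first_order a b \<phi>\<bar> \<le> (A + 1) / 2 * h + h * B"
      using \<phi> by (simp add: first_order_def)
    then show ?thesis
      by (simp add: h_def algebra_simps)
  qed
  then show ?thesis
    using first_order_distribution[OF a b] by (auto simp: Hm1_def)
qed

lemma abs_L2_loc_cases:
  obtains f where "f \<in> L2_loc_functions" "r = abs_L2_loc f"
  using L2_loc.abs_induct[of "\<lambda>r. \<exists>f\<in>L2_loc_functions. r = abs_L2_loc f" r]
  by (auto simp: L2_loc_eq_def)

lemma miura_abs:
  assumes "f \<in> L2_loc_functions"
  shows "miura (abs_L2_loc f) = first_order (\<lambda>x. - f x) (\<lambda>x. (f x)\<^sup>2)"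
proof -
  have "L2_loc_eq f f" using assms by (simp add: L2_loc_eq_def)
  from miura.abs_eq[OF this] show ?thesis
    by (auto simp: fun_eq_iff first_order_def dist_add_def dist_deriv_def dist_of_fun_def test_function_deriv)
qed

text \<open>It guarantees that the carrier of the subspace topology on the image is the entire
  image.\<close>

lemma miura_Hm1_loc: "miura r \<in> Hm1_loc"
proof -
  obtain f where f: "f \<in> L2_loc_functions" and r: "r = abs_L2_loc f"
    by (rule abs_L2_loc_cases)
  have a: "locally_integrable (\<lambda>x. - f x)" and b: "locally_integrable (\<lambda>x. (f x)\<^sup>2)"
    using L2_loc_locally_integrable[OF f] locally_integrable_mult_continuous[of "\<lambda>_. -1" f] by auto
  have "dist_mult \<eta> (miura r) \<in> Hm1" if \<eta>: "\<eta> \<in> test_functions" for \<eta>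
  proof -
    obtain N where N: "\<And>x. real N \<le> \<bar>x\<bar> \<Longrightarrow> \<eta> x = 0 \<and> deriv \<eta> x = 0"
      using test_function_support[OF \<eta>] by metis
    show ?thesis
      unfolding r miura_abs[OF f] dist_mult_first_order[OF a b \<eta>]
    proof (rule first_order_Hm1[where N = N])
      show "locally_integrable (\<lambda>x. - f x * \<eta> x)"
        by (intro locally_integrable_mult_test_function a \<eta>)
      show "locally_integrable (\<lambda>x. - f x * deriv \<eta> x + (f x)\<^sup>2 * \<eta> x)"
        by (intro locally_integrable_add locally_integrable_mult_test_function a b \<eta> test_function_deriv)
      have "locally_integrable (\<lambda>x. (f x)\<^sup>2 * (\<eta> x * \<eta> x))"
        by (intro locally_integrable_mult_test_function b test_function_mult \<eta>)
      then show "locally_integrable (\<lambda>x. (- f x * \<eta> x)\<^sup>2)"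
        by (simp add: power2_eq_square algebra_simps)
    qed (use N in auto)
  qed
  then show ?thesis
    using first_order_distribution[OF a b] by (simp add: Hm1_loc_def r miura_abs[OF f])
qed

section \<open>The fibers of the Miura map\<close>

lemma abs_L2_loc_eq_iff:
  assumes "g \<in> L2_loc_functions" "h \<in> L2_loc_functions"
  shows "abs_L2_loc g = abs_L2_loc h \<longleftrightarrow> (AE x in lebesgue. g x = h x)"
  using Quotient3_rel[OF Quotient3_L2_loc, of g h] assms by (simp add: L2_loc_eq_def)

lemma L2_loc_dist_abs:
  assumes "g \<in> L2_loc_functions" "h \<in> L2_loc_functions"
  shows "L2_loc_dist n (abs_L2_loc g) (abs_L2_loc h) = sqrt (LINT x:{- real n..real n}|lebesgue. (g x - h x)\<^sup>2)"
  using assms by (intro L2_loc_dist.abs_eq) (simp_all add: L2_loc_eq_def)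

lemma locally_integrable_diff_square:
  assumes g: "g \<in> L2_loc_functions" and h: "h \<in> L2_loc_functions"
  shows "locally_integrable (\<lambda>x. (g x - h x)\<^sup>2)"
proof -
  have "(\<lambda>x. - h x) \<in> L2_loc_functions"
    using h by (simp add: L2_loc_functions_def)
  then have "(\<lambda>x. g x + - h x) \<in> L2_loc_functions"
    by (rule L2_loc_functions_add[OF g])
  then show ?thesis
    using L2_loc_locally_integrable(1) by fastforce
qed

text \<open>
  With \<open>R' = f\<close> and \<open>I' = exp (- 2 R)\<close>, the difference \<open>w = s - f\<close> of two
  preimages solves the Bernoulli equation \<open>w' + 2 f w + w\<^sup>2 = 0\<close>, whose solutions are the
  functions \<open>w t\<close> with \<open>w t 0 = t\<close>; they live on the whole line precisely for the
  parameters in \<open>params\<close>.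
\<close>

locale miura_fiber =
  fixes f R I :: "real \<Rightarrow> real"
  assumes f: "f \<in> L2_loc_functions"
    and R: "primitive R f" and R_0: "R 0 = 0"
    and I: "primitive I (\<lambda>x. exp (- 2 * R x))" and I_0: "I 0 = 0"
begin

definition params :: "real set" where
  "params = {t. \<forall>x. 1 + t * I x > 0}"

definition w :: "real \<Rightarrow> real \<Rightarrow> real" where
  "w t x = t * exp (- 2 * R x) / (1 + t * I x)"

section \<open>The interval of parameters\<close>

lemma continuous_R: "continuous_on UNIV R"
  by (rule primitive_continuous[OF R])

lemma continuous_I: "continuous_on UNIV I"
  by (rule primitive_continuous[OF I])

lemma DERIV_I: "(I has_real_derivative exp (- 2 * R x)) (at x)"
  by (rule primitive_imp_deriv[OF I]) (intro continuous_intros continuous_R)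

lemma I_less: "x < y \<Longrightarrow> I x < I y"
  by (rule DERIV_pos_imp_increasing) (use DERIV_I exp_gt_zero in blast)+

lemma zero_in_params: "0 \<in> params"
  by (simp add: params_def)

text \<open>If 1 + t I vanished at a point, then t \<noteq> 0, and strict monotonicity of
  \<open>I\<close> would make the expression negative one step to the left or to the right. The
  non-strict description shows that \<open>params\<close> is closed.\<close>

lemma params_eq_nonneg: "params = {t. \<forall>x. 1 + t * I x \<ge> 0}"
proof -
  have "1 + t * I x \<noteq> 0" if nonneg: "\<And>x. 1 + t * I x \<ge> 0" for t x
  proof
    assume zero: "1 + t * I x = 0"
    then consider "t > 0" | "t < 0" by (cases t "0::real" rule: linorder_cases) auto
    then show False
    proof cases
      case 1
      then show False
        using mult_strict_left_mono[OF I_less[of "x - 1" x], of t] nonneg[of "x - 1"] zero by linarith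
    next
      case 2
      then show False
        using mult_strict_left_mono_neg[OF I_less[of x "x + 1"], of t] nonneg[of "x + 1"] zero by linarith
    qed
  qed
  then show ?thesis
    by (auto simp: params_def less_le)
qed

lemma params_interval: obtains a b where "params = {a..b}" "a \<le> 0" "0 \<le> b"
proof -
  have "closed {t. 1 + t * I x \<ge> 0}" for x
    by (intro closed_Collect_le continuous_intros)
  then have "closed (\<Inter>x. {t. 1 + t * I x \<ge> 0})"
    by blast
  then have "closed params"
    by (simp add: params_eq_nonneg Collect_all_eq)
  moreover have "bounded params"
  proof -
    \<comment> \<open>\<open>I\<close> takes both signs, so positivity at 1 bounds the parameter
      from below and positivity at -1 bounds it from above.\<close>
    have I1: "I 1 > 0" "I (-1) < 0"
      using I_less[of 0 1] I_less[of "-1" 0] I_0 by auto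
    have "\<bar>t\<bar> \<le> 1 / I 1 + 1 / - I (-1)" if "t \<in> params" for t
    proof -
      have "1 + t * I 1 > 0" "1 + t * I (-1) > 0"
        using that by (auto simp: params_def)
      then have "t > - (1 / I 1)" "t < 1 / - I (-1)"
        using I1 by (auto simp: field_simps)
      moreover have "1 / I 1 > 0" "1 / - I (-1) > 0"
        using I1 by auto
      ultimately show ?thesis by linarith
    qed
    then show ?thesis
      by (auto simp: bounded_iff)
  qed
  moreover have "is_interval params"
    unfolding is_interval_1
  proof (intro ballI allI impI)
    fix a b t assume a: "a \<in> params" and b: "b \<in> params" and t: "a \<le> t \<and> t \<le> b"
    have "1 + t * I x > 0" for x
    proof (cases "I x \<ge> 0")
      case True
      then have "a * I x \<le> t * I x" using t by (intro mult_right_mono) auto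
      then show ?thesis using a by (auto simp: params_def dest: spec[of _ x])
    next
      case False
      then have "b * I x \<le> t * I x" using t by (intro mult_right_mono_neg) auto
      then show ?thesis using b by (auto simp: params_def dest: spec[of _ x])
    qed
    then show "t \<in> params" by (simp add: params_def)
  qed
  ultimately obtain a b where "params = {a..b}"
    using connected_compact_interval_1[of params] by (auto simp: compact_eq_bounded_closed is_interval_connected_1)
  then show thesis
    using zero_in_params that by auto
qed

section \<open>Each admissible parameter gives a preimage\<close>

context
  fixes t assumes t: "t \<in> params"
begin

lemma denominator_pos: "1 + t * I x > 0"
  using t by (simp add: params_def)

lemma denominator_nonzero: "1 + t * I x \<noteq> 0"
  using denominator_pos[of x] by linarith

lemma continuous_w: "continuous_on UNIV (w t)"
  unfolding w_def[abs_def]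
  by (intro continuous_intros continuous_R continuous_I) (simp add: denominator_nonzero)

lemma primitive_ln: "primitive (\<lambda>x. ln (1 + t * I x)) (w t)"
proof (rule primitive_of_continuous_deriv[OF _ continuous_w])
  show "((\<lambda>x. ln (1 + t * I x)) has_real_derivative w t x) (at x)" for x
    using denominator_pos by (auto intro!: derivative_eq_intros DERIV_I simp: w_def)
qed

lemma primitive_w: "primitive (w t) (\<lambda>x. - (w t x * (2 * f x + w t x)))"
proof -
  let ?P = "\<lambda>x. (-1) * (2 * R x + ln (1 + t * I x))"
  have "w t = (\<lambda>x. t * exp (?P x))"
    using denominator_pos by (auto simp: w_def exp_diff exp_minus fun_eq_iff divide_inverse)
  moreover from this have "(\<lambda>x. - (w t x * (2 * f x + w t x))) = (\<lambda>x. t * (exp (?P x) * ((-1) * (2 * f x + w t x))))"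
    by (auto simp: fun_eq_iff algebra_simps)
  moreover have "primitive (\<lambda>x. t * exp (?P x)) (\<lambda>x. t * (exp (?P x) * ((-1) * (2 * f x + w t x))))"
    by (intro primitive_cmult primitive_exp primitive_add R primitive_ln)
  ultimately show ?thesis by simp
qed

lemma translate_L2_loc: "(\<lambda>x. f x + w t x) \<in> L2_loc_functions"
  by (intro L2_loc_functions_add f L2_loc_functions_continuous continuous_w)

text \<open>The added terms w' + 2 f w + w^2 cancel by \<open>primitive_w\<close>, here after
  pairing with a test function.\<close>

lemma miura_translate: "miura (abs_L2_loc (\<lambda>x. f x + w t x)) = miura (abs_L2_loc f)"
  unfolding miura_abs[OF f] miura_abs[OF translate_L2_loc] first_order_def
proof (rule restrict_ext)
  fix \<phi> assume \<phi>: "\<phi> \<in> test_functions"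
  note int = integrable_mult_test_function
  have liw: "locally_integrable (w t)" by (intro locally_integrable_continuous continuous_w)
  note li = L2_loc_locally_integrable[OF f] liw primitiveD(1)[OF primitive_w]
  have i: "integrable lebesgue (\<lambda>x. f x * deriv \<phi> x)" "integrable lebesgue (\<lambda>x. w t x * deriv \<phi> x)"
      "integrable lebesgue (\<lambda>x. (f x)\<^sup>2 * \<phi> x)" "integrable lebesgue (\<lambda>x. - (w t x * (2 * f x + w t x)) * \<phi> x)"
    by (intro int li \<phi> test_function_deriv)+
  have "(LINT x|lebesgue. - (f x + w t x) * deriv \<phi> x)
      = (LINT x|lebesgue. - (f x * deriv \<phi> x) - w t x * deriv \<phi> x)"
    by (simp add: algebra_simps)
  also have "\<dots> = (LINT x|lebesgue. - (f x * deriv \<phi> x)) - (LINT x|lebesgue. w t x * deriv \<phi> x)"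
    using i by (intro Bochner_Integration.integral_diff) auto
  also have "\<dots> = (LINT x|lebesgue. - f x * deriv \<phi> x) + (LINT x|lebesgue. - (w t x * (2 * f x + w t x)) * \<phi> x)"
    using primitive_imp_weak_deriv[OF primitive_w \<phi>] by simp
  finally have 1: "(LINT x|lebesgue. - (f x + w t x) * deriv \<phi> x) = \<dots>" .
  have "(LINT x|lebesgue. (f x + w t x)\<^sup>2 * \<phi> x)
      = (LINT x|lebesgue. (f x)\<^sup>2 * \<phi> x - (- (w t x * (2 * f x + w t x)) * \<phi> x))"
    by (simp add: algebra_simps power2_eq_square)
  also have "\<dots> = (LINT x|lebesgue. (f x)\<^sup>2 * \<phi> x) - (LINT x|lebesgue. - (w t x * (2 * f x + w t x)) * \<phi> x)"
    using i by (intro Bochner_Integration.integral_diff) auto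
  finally show "(LINT x|lebesgue. - (f x + w t x) * deriv \<phi> x) + (LINT x|lebesgue. (f x + w t x)\<^sup>2 * \<phi> x)
      = (LINT x|lebesgue. - f x * deriv \<phi> x) + (LINT x|lebesgue. (f x)\<^sup>2 * \<phi> x)"
    using 1 by simp
qed

end

lemma miura_eq_imp_translate:
  assumes s: "s \<in> L2_loc_functions" and eq: "miura (abs_L2_loc s) = miura (abs_L2_loc f)"
  obtains t where "t \<in> params" "AE x in lebesgue. s x = f x + w t x"
proof -
  note lis = L2_loc_locally_integrable[OF s] and lif = L2_loc_locally_integrable[OF f]
  have li_D: "locally_integrable (\<lambda>x. s x - f x)" and li_g: "locally_integrable (\<lambda>x. (f x)\<^sup>2 - (s x)\<^sup>2)"
    by (intro locally_integrable_diff lis lif)+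
  have weak: "(LINT x|lebesgue. (s x - f x) * deriv \<phi> x) = - (LINT x|lebesgue. ((f x)\<^sup>2 - (s x)\<^sup>2) * \<phi> x)"
    if \<phi>: "\<phi> \<in> test_functions" for \<phi>
  proof -
    note int = integrable_mult_test_function[OF _ \<phi>] integrable_mult_test_function[OF _ test_function_deriv[OF \<phi>]]
    have "miura (abs_L2_loc s) \<phi> = miura (abs_L2_loc f) \<phi>" using eq by simp
    then have "(LINT x|lebesgue. s x * deriv \<phi> x) - (LINT x|lebesgue. f x * deriv \<phi> x)
        = (LINT x|lebesgue. (s x)\<^sup>2 * \<phi> x) - (LINT x|lebesgue. (f x)\<^sup>2 * \<phi> x)"
      using \<phi> by (simp add: miura_abs s f first_order_def)
    moreover have "(LINT x|lebesgue. (s x - f x) * deriv \<phi> x)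
        = (LINT x|lebesgue. s x * deriv \<phi> x) - (LINT x|lebesgue. f x * deriv \<phi> x)"
      by (subst Bochner_Integration.integral_diff[symmetric]) (auto intro!: int lis lif simp: left_diff_distrib)
    moreover have "(LINT x|lebesgue. ((f x)\<^sup>2 - (s x)\<^sup>2) * \<phi> x)
        = (LINT x|lebesgue. (f x)\<^sup>2 * \<phi> x) - (LINT x|lebesgue. (s x)\<^sup>2 * \<phi> x)"
      by (subst Bochner_Integration.integral_diff[symmetric]) (auto intro!: int lis lif simp: left_diff_distrib)
    ultimately show ?thesis by simp
  qed
  \<comment> \<open>The difference has the locally integrable weak derivative f^2 - s^2, hence a
    continuous representative whose value at 0 makes sense.\<close>
  obtain W where W: "primitive W (\<lambda>x. (f x)\<^sup>2 - (s x)\<^sup>2)" and W_eq: "AE x in lebesgue. s x - f x = W x"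
    using weak_deriv_imp_primitive[OF li_D li_g weak] by metis
  have contW: "continuous_on UNIV W" by (rule primitive_continuous[OF W])
  have li_sf: "locally_integrable (\<lambda>x. s x + f x)"
    by (intro locally_integrable_add lis lif)
  note meas = locally_integrable_measurable
  have W': "primitive W (\<lambda>x. W x * (- 1 * (s x + f x)))"
  proof (rule primitive_cong_AE[OF W])
    show "AE x in lebesgue. (f x)\<^sup>2 - (s x)\<^sup>2 = W x * (- 1 * (s x + f x))"
      using W_eq by eventually_elim (auto simp: power2_eq_square algebra_simps)
    show "(\<lambda>x. W x * (- 1 * (s x + f x))) \<in> borel_measurable lebesgue"
      by (intro meas locally_integrable_mult_continuous contW li_sf continuous_intros)
  qed
  obtain V where V: "primitive V W" "V 0 = 0"
    using primitive_exists[OF locally_integrable_continuous[OF contW]] by metis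
  \<comment> \<open>Almost everywhere s + f = 2 f + W, so this is the exponent of the integrating
    factor for W' = -(s + f) W.\<close>
  have P: "primitive (\<lambda>x. 2 * R x + V x) (\<lambda>x. s x + f x)"
  proof (rule primitive_cong_AE[OF primitive_add[OF primitive_cmult[OF R] V(1)]])
    show "AE x in lebesgue. 2 * f x + W x = s x + f x"
      using W_eq by eventually_elim simp
  qed (intro meas li_sf)
  have "primitive (\<lambda>x. W x * exp (2 * R x + V x)) (\<lambda>x. 0)"
    using primitive_mult[OF W' primitive_exp[OF P]] by (simp add: algebra_simps)
  moreover have "primitive (\<lambda>x. 0) (\<lambda>x. 0)"
    by (rule primitive_of_continuous_deriv) (auto intro!: derivative_eq_intros)
  ultimately have "W x * exp (2 * R x + V x) - W 0 * exp (2 * R 0 + V 0) = 0 - 0" for x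
    by (rule primitive_eq)
  then have "W x * exp (2 * R x + V x) = W 0" for x
    by (simp add: R_0 V)
  then have "exp (- 2 * R x) * (W x * exp (2 * R x + V x)) = exp (- 2 * R x) * W 0" for x
    by simp
  moreover have "exp (- 2 * R x) * (W x * exp (2 * R x + V x)) = exp (V x) * W x" for x
    by (simp add: exp_add exp_minus)
  ultimately have W_exp: "exp (V x) * W x = W 0 * exp (- 2 * R x)" for x
    by (simp add: mult.commute)
  have "primitive (\<lambda>x. exp (V x)) (\<lambda>x. W 0 * exp (- 2 * R x))"
    using primitive_exp[OF V(1)] by (simp add: W_exp)
  moreover have "primitive (\<lambda>x. W 0 * I x) (\<lambda>x. W 0 * exp (- 2 * R x))"
    by (intro primitive_cmult I)
  ultimately have "exp (V x) - exp (V 0) = W 0 * I x - W 0 * I 0" for x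
    by (rule primitive_eq)
  then have expV: "exp (V x) = 1 + W 0 * I x" for x
    using V I_0 by (simp add: algebra_simps)
  show thesis
  proof
    have "1 + W 0 * I x > 0" for x
      using exp_gt_zero[of "V x"] by (simp only: expV)
    then show "W 0 \<in> params"
      by (simp add: params_def)
    have W_w: "W x = w (W 0) x" for x
      using W_exp[of x] exp_gt_zero[of "V x"] unfolding w_def expV[symmetric]
      by (simp add: field_simps)
    show "AE x in lebesgue. s x = f x + w (W 0) x"
      using W_eq
    proof eventually_elim
      case (elim x)
      then show ?case using W_w[of x] by linarith
    qed
  qed
qed

lemma w_at_0: "w t 0 = t"
  by (simp add: w_def R_0 I_0)

text \<open>Equality almost everywhere does not compare values at 0 directly. But ln(1 + s I)
  becomes a primitive of both functions, and as they are continuous, both equal its derivative at 0,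
  where they take the values \<open>s\<close> and \<open>t\<close>.\<close>

lemma w_AE_inject:
  assumes s: "s \<in> params" and t: "t \<in> params" and ae: "AE x in lebesgue. w s x = w t x"
  shows "s = t"
proof -
  have "primitive (\<lambda>x. ln (1 + s * I x)) (w t)"
    by (rule primitive_cong_AE[OF primitive_ln[OF s] ae])
       (intro locally_integrable_measurable locally_integrable_continuous continuous_w t)
  from primitive_imp_deriv[OF this continuous_w[OF t], of 0]
    primitive_imp_deriv[OF primitive_ln[OF s] continuous_w[OF s], of 0]
  have "w t 0 = w s 0"
    by (rule DERIV_unique)
  then show ?thesis by (simp add: w_at_0)
qed

definition preimage :: "real \<Rightarrow> L2_loc" where
  "preimage t = abs_L2_loc (\<lambda>x. f x + w t x)"

lemma inj_on_preimage: "inj_on preimage params"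
proof
  fix s t assume st: "s \<in> params" "t \<in> params" "preimage s = preimage t"
  then have "AE x in lebesgue. f x + w s x = f x + w t x"
    by (simp add: preimage_def abs_L2_loc_eq_iff translate_L2_loc)
  then show "s = t"
    by (intro w_AE_inject st) simp
qed

lemma preimage_image: "preimage ` params = miura -` {miura (abs_L2_loc f)}"
proof (intro equalityI subsetI)
  fix r assume "r \<in> miura -` {miura (abs_L2_loc f)}"
  moreover obtain s where s: "s \<in> L2_loc_functions" "r = abs_L2_loc s"
    by (rule abs_L2_loc_cases)
  ultimately obtain t where t: "t \<in> params" "AE x in lebesgue. s x = f x + w t x"
    using miura_eq_imp_translate[OF s(1)] by auto
  then have "r = preimage t"
    by (simp add: s preimage_def abs_L2_loc_eq_iff translate_L2_loc)
  with t show "r \<in> preimage ` params" by blast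
qed (auto simp: preimage_def miura_translate)

text \<open>Dominated convergence: compactness of \<open>params\<close> bounds \<open>w\<close> by
  one constant \<open>C\<close> on \<open>params\<close> times the interval, and 2 (g - f)^2 + 2 C^2
  dominates the integrands.\<close>

lemma continuous_L2_loc_dist_preimage: "continuous_on params (\<lambda>t. L2_loc_dist n r (preimage t))"
proof -
  obtain g where g: "g \<in> L2_loc_functions" "r = abs_L2_loc g"
    by (rule abs_L2_loc_cases)
  obtain a b where ab: "params = {a..b}"
    using params_interval by metis
  let ?J = "{- real n..real n}"
  let ?F = "\<lambda>t x. indicator ?J x * (g x - (f x + w t x))\<^sup>2"
  have "continuous_on (params \<times> ?J) (\<lambda>z. w (fst z) (snd z))"
    unfolding w_def
    by (intro continuous_intros continuous_on_compose2[OF continuous_R] continuous_on_compose2[OF continuous_I])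
       (auto simp: denominator_nonzero)
  then have "compact ((\<lambda>z. w (fst z) (snd z)) ` (params \<times> ?J))"
    by (rule compact_continuous_image) (auto simp: ab intro!: compact_Times)
  then obtain C where C: "\<And>t x. t \<in> params \<Longrightarrow> x \<in> ?J \<Longrightarrow> \<bar>w t x\<bar> \<le> C"
    using compact_imp_bounded by (force simp: bounded_iff)
  have "continuous_on params (\<lambda>t. LINT x|lebesgue. ?F t x)"
    unfolding continuous_on_sequentially comp_def
  proof safe
    fix \<tau> :: "nat \<Rightarrow> real" and t assume t: "t \<in> params" and \<tau>: "\<forall>k. \<tau> k \<in> params" and lim: "\<tau> \<longlonglongrightarrow> t"
    have m: "?F u \<in> borel_measurable lebesgue" if "u \<in> params" for u
      using locally_integrableD[OF locally_integrable_diff_square[OF g(1) translate_L2_loc[OF that]], of "- real n" "real n"]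
      by (simp add: set_integrable_def)
    show "(\<lambda>k. LINT x|lebesgue. ?F (\<tau> k) x) \<longlonglongrightarrow> (LINT x|lebesgue. ?F t x)"
    proof (rule integral_dominated_convergence)
      have "locally_integrable (\<lambda>x. 2 * (g x - f x)\<^sup>2 + 2 * C\<^sup>2)"
        by (intro locally_integrable_add locally_integrable_mult_continuous[of "\<lambda>_. 2" "\<lambda>x. (g x - f x)\<^sup>2"]
              locally_integrable_diff_square g f locally_integrable_continuous continuous_intros)
      from locally_integrableD[OF this, of "- real n" "real n"]
      show "integrable lebesgue (\<lambda>x. indicator ?J x * (2 * (g x - f x)\<^sup>2 + 2 * C\<^sup>2))"
        by (simp add: set_integrable_def)
      show "AE x in lebesgue. norm (?F (\<tau> k) x) \<le> indicator ?J x * (2 * (g x - f x)\<^sup>2 + 2 * C\<^sup>2)" for k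
      proof (intro AE_I2)
        fix x
        have "(y - z)\<^sup>2 \<le> 2 * y\<^sup>2 + 2 * C\<^sup>2" if "\<bar>z\<bar> \<le> C" for y z
        proof -
          have "(y - z)\<^sup>2 \<le> 2 * y\<^sup>2 + 2 * z\<^sup>2"
            using zero_le_power2[of "y + z"] by (simp add: power2_eq_square algebra_simps)
          moreover have "z\<^sup>2 \<le> C\<^sup>2"
            using power_mono[OF that, of 2] by simp
          ultimately show ?thesis by linarith
        qed
        from this[of "w (\<tau> k) x" "g x - f x"]
        show "norm (?F (\<tau> k) x) \<le> indicator ?J x * (2 * (g x - f x)\<^sup>2 + 2 * C\<^sup>2)"
          using C[of "\<tau> k" x] \<tau> by (auto simp: indicator_def algebra_simps)
      qed
      show "AE x in lebesgue. (\<lambda>k. ?F (\<tau> k) x) \<longlonglongrightarrow> ?F t x"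
        unfolding w_def
        by (intro AE_I2 tendsto_intros lim) (rule denominator_nonzero[OF t])
    qed (use m t \<tau> in auto)
  qed
  then have "continuous_on params (\<lambda>t. sqrt (LINT x|lebesgue. ?F t x))"
    by (intro continuous_intros)
  then show ?thesis
    by (rule continuous_on_eq)
       (simp add: g preimage_def L2_loc_dist_abs translate_L2_loc set_lebesgue_integral_def)
qed

end

section \<open>The topology of the fibers, and density\<close>

lemma L2_loc_dist_square:
  assumes "g \<in> L2_loc_functions" "h \<in> L2_loc_functions"
  shows "(L2_loc_dist n (abs_L2_loc g) (abs_L2_loc h))\<^sup>2 = integral {- real n..real n} (\<lambda>x. (g x - h x)\<^sup>2)"
proof -
  have si: "set_integrable lebesgue {- real n..real n} (\<lambda>x. (g x - h x)\<^sup>2)"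
    by (intro locally_integrableD locally_integrable_diff_square assms)
  show ?thesis
    by (simp add: L2_loc_dist_abs assms set_lebesgue_integral_eq_integral[OF si]
        Henstock_Kurzweil_Integration.integral_nonneg)
qed

lemma L2_loc_dist_nonneg: "L2_loc_dist n r s \<ge> 0"
proof -
  obtain g h where "g \<in> L2_loc_functions" "r = abs_L2_loc g" "h \<in> L2_loc_functions" "s = abs_L2_loc h"
    by (metis abs_L2_loc_cases)
  then show ?thesis
    by (simp add: L2_loc_dist_abs set_lebesgue_integral_def Bochner_Integration.integral_nonneg)
qed

lemma L2_loc_dist_self: "L2_loc_dist n r r = 0"
proof -
  obtain g where "g \<in> L2_loc_functions" "r = abs_L2_loc g"
    by (rule abs_L2_loc_cases)
  then show ?thesis
    by (simp add: L2_loc_dist_abs set_lebesgue_integral_def)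
qed

text \<open>A squared form of the triangle inequality that follows pointwise under the integral and
  suffices to separate points.\<close>

lemma L2_loc_dist_parallelogram:
  "(L2_loc_dist n r s)\<^sup>2 \<le> 2 * (L2_loc_dist n r u)\<^sup>2 + 2 * (L2_loc_dist n s u)\<^sup>2"
proof -
  obtain f g h where fgh: "f \<in> L2_loc_functions" "r = abs_L2_loc f" "g \<in> L2_loc_functions" "s = abs_L2_loc g"
     "h \<in> L2_loc_functions" "u = abs_L2_loc h"
    by (metis abs_L2_loc_cases)
  let ?J = "{- real n..real n}"
  have i: "(\<lambda>x. (p x - q x)\<^sup>2) integrable_on ?J" if "p \<in> L2_loc_functions" "q \<in> L2_loc_functions" for p q
    by (intro locally_integrable_imp_integrable_on locally_integrable_diff_square that)
  have "integral ?J (\<lambda>x. (f x - g x)\<^sup>2) \<le> integral ?J (\<lambda>x. 2 * (f x - h x)\<^sup>2 + 2 * (g x - h x)\<^sup>2)"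
  proof (rule Henstock_Kurzweil_Integration.integral_le)
    show "(f x - g x)\<^sup>2 \<le> 2 * (f x - h x)\<^sup>2 + 2 * (g x - h x)\<^sup>2" for x
      using zero_le_power2[of "(f x - h x) + (g x - h x)"] by (simp add: power2_eq_square algebra_simps)
  qed (intro integrable_add integrable_on_mult_right i fgh)+
  also have "\<dots> = 2 * integral ?J (\<lambda>x. (f x - h x)\<^sup>2) + 2 * integral ?J (\<lambda>x. (g x - h x)\<^sup>2)"
    by (subst Henstock_Kurzweil_Integration.integral_add) (auto intro!: integrable_on_mult_right i fgh)
  finally show ?thesis
    by (simp add: fgh L2_loc_dist_square)
qed

lemma L2_loc_dist_separates:
  assumes "\<And>n. L2_loc_dist n r s = 0"
  shows "r = s"
proof -
  obtain g h where gh: "g \<in> L2_loc_functions" "r = abs_L2_loc g" "h \<in> L2_loc_functions" "s = abs_L2_loc h"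
    by (metis abs_L2_loc_cases)
  have "AE x in lebesgue. x \<in> {- real n..real n} \<longrightarrow> g x = h x" for n
  proof -
    have "integrable lebesgue (\<lambda>x. indicator {- real n..real n} x * (g x - h x)\<^sup>2)"
      using locally_integrableD[OF locally_integrable_diff_square[OF gh(1,3)], of "- real n" "real n"]
      by (simp add: set_integrable_def)
    moreover have "(LINT x|lebesgue. indicator {- real n..real n} x * (g x - h x)\<^sup>2) = 0"
      using assms[of n] by (simp add: gh L2_loc_dist_abs set_lebesgue_integral_def)
    ultimately have "AE x in lebesgue. indicator {- real n..real n} x * (g x - h x)\<^sup>2 = 0"
      by (subst (asm) integral_nonneg_eq_0_iff_AE) auto
    then show ?thesis
      by eventually_elim (auto simp: indicator_def split: if_splits)
  qed
  then have "AE x in lebesgue. \<forall>n. x \<in> {- real n..real n} \<longrightarrow> g x = h x"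
    by (subst AE_all_countable) blast
  then have "AE x in lebesgue. g x = h x"
  proof eventually_elim
    case (elim x)
    obtain n where "\<bar>x\<bar> \<le> real n"
      using real_arch_simple by blast
    then show ?case using elim by (auto simp: abs_le_iff)
  qed
  then show ?thesis
    by (simp add: gh abs_L2_loc_eq_iff)
qed

lemma openin_L2_loc_ball: "e > 0 \<Longrightarrow> openin L2_loc_topology {y. L2_loc_dist n r y < e}"
  unfolding L2_loc_topology_def seminorm_topology_def by (rule topology_generated_by_Basis) auto

lemma topspace_L2_loc: "topspace L2_loc_topology = UNIV"
proof -
  have "r \<in> topspace L2_loc_topology" for r
    using openin_subset[OF openin_L2_loc_ball[of 1 0 r]] by (auto simp: L2_loc_dist_self)
  then show ?thesis by blast
qed

lemma Hausdorff_L2_loc: "Hausdorff_space L2_loc_topology"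
  unfolding Hausdorff_space_def
proof (intro allI impI)
  fix r s assume "r \<in> topspace L2_loc_topology \<and> s \<in> topspace L2_loc_topology \<and> r \<noteq> s"
  then obtain n where "L2_loc_dist n r s \<noteq> 0"
    using L2_loc_dist_separates by blast
  then have pos: "L2_loc_dist n r s > 0"
    using L2_loc_dist_nonneg[of n r s] by simp
  \<comment> \<open>A common point of the two balls of radius \<open>d\<close> would make the
    squared distance smaller than 2 d^2 + 2 d^2, which is that squared distance itself.\<close>
  define d where "d = L2_loc_dist n r s / 2"
  have "d > 0" using pos by (simp add: d_def)
  have "False" if "L2_loc_dist n r u < d" "L2_loc_dist n s u < d" for u
  proof -
    have "(L2_loc_dist n r u)\<^sup>2 < d\<^sup>2" "(L2_loc_dist n s u)\<^sup>2 < d\<^sup>2"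
      using that by (auto intro!: power_strict_mono L2_loc_dist_nonneg)
    then show False
      using L2_loc_dist_parallelogram[of n r s u] by (simp add: d_def power_divide)
  qed
  then show "\<exists>U V. openin L2_loc_topology U \<and> openin L2_loc_topology V \<and> r \<in> U \<and> s \<in> V \<and> disjnt U V"
    using \<open>d > 0\<close>
    by (intro exI[of _ "{y. L2_loc_dist n r y < d}"] exI[of _ "{y. L2_loc_dist n s y < d}"])
       (auto simp: openin_L2_loc_ball L2_loc_dist_self disjnt_def)
qed

context miura_fiber
begin

lemma continuous_map_preimage: "continuous_map (top_of_set params) L2_loc_topology preimage"
  unfolding L2_loc_topology_def seminorm_topology_def
proof (rule continuous_on_generated_topo)
  fix U assume "U \<in> {{y \<in> UNIV. L2_loc_dist i x y < e} | i x e. i \<in> UNIV \<and> x \<in> UNIV \<and> e > 0}"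
  then obtain n r e where U: "U = {y. L2_loc_dist n r y < e}" by blast
  have "openin (top_of_set params) (params \<inter> (\<lambda>t. L2_loc_dist n r (preimage t)) -` {..<e})"
    by (rule continuous_openin_preimage_gen[OF continuous_L2_loc_dist_preimage]) simp
  then show "openin (top_of_set params) (preimage -` U \<inter> topspace (top_of_set params))"
    by (simp add: U Int_commute vimage_def)
next
  show "preimage ` topspace (top_of_set params) \<subseteq>
      \<Union> {{y \<in> UNIV. L2_loc_dist i x y < e} | i x e. i \<in> UNIV \<and> x \<in> UNIV \<and> e > 0}"
    using topspace_L2_loc unfolding L2_loc_topology_def seminorm_topology_def topology_generated_by_topspace
    by simp
qed

lemma fiber_homeomorphic_params:
  "subtopology L2_loc_topology (miura -` {miura (abs_L2_loc f)}) homeomorphic_space top_of_set params"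
proof -
  let ?F = "miura -` {miura (abs_L2_loc f)}"
  obtain a b where ab: "params = {a..b}"
    using params_interval by metis
  have "homeomorphic_map (top_of_set params) (subtopology L2_loc_topology ?F) preimage"
  proof (rule continuous_imp_homeomorphic_map)
    show "continuous_map (top_of_set params) (subtopology L2_loc_topology ?F) preimage"
      using continuous_map_preimage preimage_image by (auto simp: continuous_map_in_subtopology)
    show "compact_space (top_of_set params)"
      by (simp add: ab compact_space_subtopology)
    show "Hausdorff_space (subtopology L2_loc_topology ?F)"
      by (intro Hausdorff_space_subtopology Hausdorff_L2_loc)
    show "preimage ` topspace (top_of_set params) = topspace (subtopology L2_loc_topology ?F)"
      by (simp add: preimage_image topspace_L2_loc)
    show "inj_on preimage (topspace (top_of_set params))"
      by (simp add: inj_on_preimage)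
  qed
  then show ?thesis
    using homeomorphic_map_imp_homeomorphic_space homeomorphic_space_sym by blast
qed

lemma E1_of_trivial_params:
  assumes "params = {0}"
  shows "miura (abs_L2_loc f) \<in> E1"
  using preimage_image assms by (auto simp: E1_def)

lemma E2_of_nontrivial_params:
  assumes "params \<noteq> {0}"
  shows "miura (abs_L2_loc f) \<in> E2"
proof -
  obtain a b where "params = {a..b}" "a \<le> 0" "0 \<le> b"
    by (rule params_interval)
  moreover from this have "a < b"
    using assms by (cases "a = b") auto
  ultimately show ?thesis
    using fiber_homeomorphic_params by (auto simp: E2_def)
qed

end

lemma miura_fiber_exists:
  assumes "f \<in> L2_loc_functions"
  obtains R I where "miura_fiber f R I"
proof -
  obtain R where R: "primitive R f" "R 0 = 0"
    using primitive_exists[OF L2_loc_locally_integrable(2)[OF assms]] by metis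
  have "continuous_on UNIV (\<lambda>x. exp (- 2 * R x))"
    by (intro continuous_intros primitive_continuous[OF R(1)])
  then obtain I where "primitive I (\<lambda>x. exp (- 2 * R x))" "I 0 = 0"
    using primitive_exists[OF locally_integrable_continuous] by metis
  with R assms show thesis
    by (intro that[of R I]) unfold_locales
qed

lemma range_miura_eq: "range miura = E1 \<union> E2"
proof
  show "range miura \<subseteq> E1 \<union> E2"
  proof
    fix q assume "q \<in> range miura"
    then obtain f where f: "f \<in> L2_loc_functions" "q = miura (abs_L2_loc f)"
      by (metis abs_L2_loc_cases rangeE)
    obtain R I where "miura_fiber f R I"
      by (rule miura_fiber_exists[OF f(1)])
    then show "q \<in> E1 \<union> E2"
      using miura_fiber.E1_of_trivial_params miura_fiber.E2_of_nontrivial_params f(2) by blast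
  qed
qed (auto simp: E1_def E2_def)

section \<open>Changing a preimage near infinity\<close>

text \<open>The points -N and N belong to the tails, so for N > 0 the function is constant on the
  closed half lines. The left tail is zero in both applications; \<open>c\<close> selects the type
  of fiber.\<close>

definition replace_tails :: "nat \<Rightarrow> real \<Rightarrow> (real \<Rightarrow> real) \<Rightarrow> real \<Rightarrow> real" where
  "replace_tails N c f x = (if x \<le> - real N then 0 else if x < real N then f x else c)"

lemma replace_tails_L2_loc:
  assumes f: "f \<in> L2_loc_functions"
  shows "replace_tails N c f \<in> L2_loc_functions"
proof -
  have *: "(\<lambda>x. indicator A x * g x) \<in> L2_loc_functions"
    if A: "A \<in> sets lebesgue" and g: "g \<in> L2_loc_functions" for A and g :: "real \<Rightarrow> real"
  proof (rule L2_loc_functionsI)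
    show m: "(\<lambda>x. indicator A x * g x) \<in> borel_measurable lebesgue"
      using g by (intro borel_measurable_times borel_measurable_indicator A) (simp add: L2_loc_functions_def)
    have "(\<lambda>x. (indicator A x * g x)\<^sup>2) absolutely_integrable_on {a..b}" for a b
    proof (rule measurable_bounded_by_integrable_imp_absolutely_integrable)
      show "(\<lambda>x. (indicator A x * g x)\<^sup>2) \<in> borel_measurable (lebesgue_on {a..b})"
        by (intro measurable_restrict_space1 borel_measurable_power m)
      show "(\<lambda>x. (g x)\<^sup>2) integrable_on {a..b}"
        by (intro locally_integrable_imp_integrable_on L2_loc_locally_integrable g)
      show "norm ((indicator A x * g x)\<^sup>2) \<le> (g x)\<^sup>2" for x
        by (simp add: indicator_def)
    qed simp
    then show "locally_integrable (\<lambda>x. (indicator A x * g x)\<^sup>2)"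
      by (simp add: locally_integrable_def)
  qed
  \<comment> \<open>For \<open>N = 0\<close> the intersection removes the origin, which belongs to
    the left tail.\<close>
  have "(\<lambda>x. indicator {- real N<..<real N} x * f x + indicator ({real N..} \<inter> {- real N<..}) x * c) \<in> L2_loc_functions"
    by (intro L2_loc_functions_add * f L2_loc_functions_continuous continuous_intros) auto
  moreover have "(\<lambda>x. indicator {- real N<..<real N} x * f x + indicator ({real N..} \<inter> {- real N<..}) x * c)
      = replace_tails N c f"
    by (auto simp: replace_tails_def indicator_def fun_eq_iff)
  ultimately show ?thesis by simp
qed

text \<open>The function changes only where |x| is at least M + 1 > N. The successor provides the
  strict inequality under which the derivative of \<phi> vanishes along with \<phi>.\<close>

lemma miura_replace_tails:
  assumes f: "f \<in> L2_loc_functions" and \<phi>: "\<phi> \<in> test_functions" and N: "\<And>x. real N \<le> \<bar>x\<bar> \<Longrightarrow> \<phi> x = 0"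
    and "N \<le> M"
  shows "miura (abs_L2_loc (replace_tails (Suc M) c f)) \<phi> = miura (abs_L2_loc f) \<phi>"
proof -
  have z: "\<phi> x = 0" "deriv \<phi> x = 0" if "replace_tails (Suc M) c f x \<noteq> f x" for x
  proof -
    have "real N < \<bar>x\<bar>"
      using that \<open>N \<le> M\<close> by (auto simp: replace_tails_def split: if_splits)
    then show "\<phi> x = 0" "deriv \<phi> x = 0"
      using N by (auto intro!: deriv_eq_0_outside[of "real N"])
  qed
  have eq: "- replace_tails (Suc M) c f x * deriv \<phi> x = - f x * deriv \<phi> x"
    "(replace_tails (Suc M) c f x)\<^sup>2 * \<phi> x = (f x)\<^sup>2 * \<phi> x" for x
    using z[of x] by (cases "replace_tails (Suc M) c f x = f x"; simp)+
  show ?thesis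
    by (simp only: miura_abs replace_tails_L2_loc f first_order_def restrict_apply \<phi> if_True eq)
qed

lemma primitive_const_on:
  assumes F: "primitive F f" and "a \<le> b" and c: "\<And>x. x \<in> {a..b} \<Longrightarrow> f x = c"
  shows "F b = F a + c * (b - a)"
proof -
  have "F b - F a = integral {a..b} f"
    using primitiveD(2)[OF F \<open>a \<le> b\<close>] by simp
  also have "\<dots> = integral {a..b} (\<lambda>_. c)"
    by (rule integral_cong) (rule c)
  finally show ?thesis
    using \<open>a \<le> b\<close> by (simp add: mult.commute)
qed

text \<open>On each tail \<open>R\<close> is constant, so \<open>I\<close> is affine there with
  positive slope, \<open>l\<close> on the left and \<open>r\<close> on the right, and no nonzero
  parameter survives.\<close>

lemma replace_tails_0_E1:
  assumes f: "f \<in> L2_loc_functions"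
  shows "miura (abs_L2_loc (replace_tails N 0 f)) \<in> E1"
proof -
  obtain R I where "miura_fiber (replace_tails N 0 f) R I"
    by (rule miura_fiber_exists[OF replace_tails_L2_loc[OF f]])
  then interpret miura_fiber "replace_tails N 0 f" R I .
  define l r where "l = exp (- 2 * R (- real N))" and "r = exp (- 2 * R (real N))"
  have R_right: "R x = R (real N)" if "real N \<le> x" for x
    using primitive_const_on[OF R that, of 0] by (simp add: replace_tails_def)
  have right: "I x = I (real N) + r * (x - real N)" if "real N \<le> x" for x
    unfolding r_def by (rule primitive_const_on[OF I that]) (subst R_right, auto)
  have R_left: "R x = R (- real N)" if "x \<le> - real N" for x
    using primitive_const_on[OF R that, of 0] by (simp add: replace_tails_def)
  have left: "I (- real N) = I x + l * (- real N - x)" if "x \<le> - real N" for x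
    unfolding l_def by (rule primitive_const_on[OF I that]) (subst R_left, auto)
  have pos: "l > 0" "r > 0" by (simp_all add: l_def r_def)
  have "t = 0" if t: "t \<in> params" for t
  proof (rule ccontr)
    assume "t \<noteq> 0"
    then consider "t < 0" | "t > 0" by linarith
    then show False
    proof cases
      case 1
      \<comment> \<open>Far enough to the right that I(x) \<ge> -1/t, which forces 1 + t I(x) \<le>
        0; for positive t the mirrored choice on the left tail is used.\<close>
      define x where "x = real N + (\<bar>I (real N)\<bar> + 1 / - t) / r"
      have "(\<bar>I (real N)\<bar> + 1 / - t) / r \<ge> 0"
        using 1 pos by (intro divide_nonneg_pos add_nonneg_nonneg) auto
      then have "real N \<le> x" by (simp add: x_def)
      moreover have "r * (x - real N) = \<bar>I (real N)\<bar> + 1 / - t"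
        using pos by (simp add: x_def)
      ultimately have "I x = I (real N) + \<bar>I (real N)\<bar> + 1 / - t"
        using right[of x] by linarith
      then have "I x \<ge> 1 / - t" by linarith
      then have "t * I x \<le> t * (1 / - t)"
        using 1 by (intro mult_left_mono_neg) auto
      then show False
        using t 1 by (auto simp: params_def dest: spec[of _ x])
    next
      case 2
      define x where "x = - real N - (\<bar>I (- real N)\<bar> + 1 / t) / l"
      have "(\<bar>I (- real N)\<bar> + 1 / t) / l \<ge> 0"
        using 2 pos by (intro divide_nonneg_pos add_nonneg_nonneg) auto
      then have "x \<le> - real N" by (simp add: x_def)
      moreover have "l * (- real N - x) = \<bar>I (- real N)\<bar> + 1 / t"
        using pos by (simp add: x_def)
      ultimately have "I x = I (- real N) - \<bar>I (- real N)\<bar> - 1 / t"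
        using left[of x] by linarith
      then have "I x \<le> - (1 / t)" by linarith
      then have "t * I x \<le> t * (- (1 / t))"
        using 2 by (intro mult_left_mono) auto
      then show False
        using t 2 by (auto simp: params_def dest: spec[of _ x])
    qed
  qed
  then show ?thesis
    using zero_in_params by (intro E1_of_trivial_params) auto
qed

lemma replace_tails_1_E2:
  assumes f: "f \<in> L2_loc_functions"
  shows "miura (abs_L2_loc (replace_tails (Suc N) 1 f)) \<in> E2"
proof -
  \<comment> \<open>A positive cutoff keeps the two tails disjoint, so that the value at the cutoff
    is 1.\<close>
  let ?N = "real (Suc N)"
  obtain R I where "miura_fiber (replace_tails (Suc N) 1 f) R I"
    by (rule miura_fiber_exists[OF replace_tails_L2_loc[OF f]])
  then interpret miura_fiber "replace_tails (Suc N) 1 f" R I .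
  have R_right: "R x = R ?N + (x - ?N)" if "?N \<le> x" for x
    using primitive_const_on[OF R that, of 1] by (simp add: replace_tails_def)
  \<comment> \<open>On the right tail \<open>R\<close> has slope 1, and the second summand is the
    integral of exp(-2 R) over that entire tail.\<close>
  define K where "K = I ?N + exp (- 2 * R ?N) / 2"
  have le_K: "I x \<le> K" for x
  proof (cases "?N \<le> x")
    case True
    let ?H = "\<lambda>y. - exp (- 2 * (R ?N + (y - ?N))) / 2"
    have "((\<lambda>y. exp (- 2 * (R ?N + (y - ?N)))) has_integral (?H x - ?H ?N)) {?N..x}"
      using True by (intro fundamental_theorem_of_calculus)
        (auto intro!: derivative_eq_intros simp: has_real_derivative_iff_has_vector_derivative[symmetric])
    then have "integral {?N..x} (\<lambda>y. exp (- 2 * (R ?N + (y - ?N)))) = ?H x - ?H ?N"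
      by (rule integral_unique)
    moreover have "integral {?N..x} (\<lambda>y. exp (- 2 * R y)) = integral {?N..x} (\<lambda>y. exp (- 2 * (R ?N + (y - ?N))))"
      by (rule integral_cong) (subst R_right, auto)
    moreover have "?H ?N = - exp (- 2 * R ?N) / 2"
      by simp
    ultimately have "I x - I ?N = ?H x + exp (- 2 * R ?N) / 2"
      using primitiveD(2)[OF I True] by linarith
    then show ?thesis
      using exp_gt_zero[of "- 2 * (R ?N + (x - ?N))"] unfolding K_def by linarith
  next
    case False
    then have "I x < I ?N" by (intro I_less) simp
    then show ?thesis
      using exp_gt_zero[of "- 2 * R ?N"] unfolding K_def by linarith
  qed
  have "K \<ge> 0"
    using le_K[of 0] I_0 by simp
  \<comment> \<open>With K + 1 in place of K the denominator is positive even if K = 0, and the left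
    side is at least 1/(K + 1).\<close>
  have "1 + - (1 / (K + 1)) * I x > 0" for x
    using le_K[of x] \<open>K \<ge> 0\<close> by (simp add: field_simps)
  then have "- (1 / (K + 1)) \<in> params"
    unfolding params_def by blast
  moreover have "- (1 / (K + 1)) \<noteq> 0"
    using \<open>K \<ge> 0\<close> by simp
  ultimately have "params \<noteq> {0}" by blast
  then show ?thesis by (rule E2_of_nontrivial_params)
qed

section \<open>Neighbourhoods in \<open>Hm1_loc_topology\<close> and density\<close>

lemma Hm1_norm_zero: "Hm1_norm (\<lambda>\<phi>\<in>test_functions. 0) = 0"
proof -
  \<comment> \<open>The index set must be nonempty for the supremum of a constant to be that
    constant.\<close>
  have "(\<lambda>x. 0) \<in> {\<phi> \<in> test_functions. H1_norm \<phi> \<le> 1}"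
    by (simp add: test_function_zero H1_norm_def)
  then have "{\<phi> \<in> test_functions. H1_norm \<phi> \<le> 1} \<noteq> {}" by blast
  moreover have "Hm1_norm (\<lambda>\<phi>\<in>test_functions. 0) = (SUP \<phi>\<in>{\<phi> \<in> test_functions. H1_norm \<phi> \<le> 1}. 0)"
    unfolding Hm1_norm_def by (rule SUP_cong) auto
  ultimately show ?thesis by simp
qed

text \<open>The seminorm of the zero test function vanishes, so the unit ball around
  \<open>u\<close> for this seminorm is a subbasic set containing \<open>u\<close>.\<close>

lemma topspace_Hm1_loc: "topspace Hm1_loc_topology = Hm1_loc"
proof
  show "Hm1_loc \<subseteq> topspace Hm1_loc_topology"
  proof
    fix u assume u: "u \<in> Hm1_loc"
    let ?d = "\<lambda>\<eta> u v. Hm1_norm (dist_mult \<eta> (dist_diff u v))"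
    have "dist_mult (\<lambda>x. 0) (dist_diff u u) = (\<lambda>\<phi>\<in>test_functions. 0)"
      by (auto simp: dist_mult_def dist_diff_def test_function_zero fun_eq_iff)
    then have "u \<in> {v \<in> Hm1_loc. ?d (\<lambda>x. 0) u v < 1}"
      using u by (simp add: Hm1_norm_zero)
    moreover have "{v \<in> Hm1_loc. ?d (\<lambda>x. 0) u v < 1} \<in>
        {{v \<in> Hm1_loc. ?d \<eta> x v < e} | \<eta> x e. \<eta> \<in> test_functions \<and> x \<in> Hm1_loc \<and> e > 0}"
      using u test_function_zero zero_less_one by blast
    ultimately show "u \<in> topspace Hm1_loc_topology"
      unfolding Hm1_loc_topology_def seminorm_topology_def topology_generated_by_topspace by blast
  qed
qed (auto simp: Hm1_loc_topology_def seminorm_topology_def)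

text \<open>The seminorm of \<eta> evaluates a distribution only on products \<eta> \<phi>, which
  vanish where \<eta> does. Hence membership in a subbasic ball depends only on test functions
  supported in a bounded interval, and finite intersections and unions preserve this.\<close>

lemma openin_Hm1_loc_local:
  assumes "openin Hm1_loc_topology U" "q \<in> U"
  shows "\<exists>N::nat. \<forall>p\<in>Hm1_loc.
    (\<forall>\<phi>\<in>test_functions. (\<forall>x. real N \<le> \<bar>x\<bar> \<longrightarrow> \<phi> x = 0) \<longrightarrow> p \<phi> = q \<phi>) \<longrightarrow> p \<in> U"
  using assms(1)[unfolded Hm1_loc_topology_def seminorm_topology_def openin_topology_generated_by_iff] assms(2)
proof (induction rule: generate_topology_on.induct)
  case (Int A B)
  then obtain N M where
    "\<And>p. p \<in> Hm1_loc \<Longrightarrow> (\<forall>\<phi>\<in>test_functions. (\<forall>x. real N \<le> \<bar>x\<bar> \<longrightarrow> \<phi> x = 0) \<longrightarrow> p \<phi> = q \<phi>) \<Longrightarrow> p \<in> A"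
    "\<And>p. p \<in> Hm1_loc \<Longrightarrow> (\<forall>\<phi>\<in>test_functions. (\<forall>x. real M \<le> \<bar>x\<bar> \<longrightarrow> \<phi> x = 0) \<longrightarrow> p \<phi> = q \<phi>) \<Longrightarrow> p \<in> B"
    by blast
  then show ?case
    by (intro exI[of _ "max N M"]) (simp add: of_nat_max)
next
  case (Basis U)
  then obtain \<eta> x e where \<eta>: "\<eta> \<in> test_functions"
    and U: "U = {y \<in> Hm1_loc. Hm1_norm (dist_mult \<eta> (dist_diff x y)) < e}" by blast
  obtain N where N: "\<And>x. real N \<le> \<bar>x\<bar> \<Longrightarrow> \<eta> x = 0"
    using test_function_support[OF \<eta>] by metis
  show ?case
  proof (intro exI[of _ N] ballI impI)
    fix p assume p: "p \<in> Hm1_loc"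
      and eq: "\<forall>\<phi>\<in>test_functions. (\<forall>x. real N \<le> \<bar>x\<bar> \<longrightarrow> \<phi> x = 0) \<longrightarrow> p \<phi> = q \<phi>"
    \<comment> \<open>The localised differences coincide, so \<open>p\<close> and \<open>q\<close>
      have the same distance from the centre \<open>x\<close>, which may differ from
      \<open>q\<close>.\<close>
    have "dist_mult \<eta> (dist_diff x p) = dist_mult \<eta> (dist_diff x q)"
      using eq N by (auto simp: dist_mult_def dist_diff_def fun_eq_iff restrict_def test_function_mult[OF \<eta>])
    then show "p \<in> U"
      using p Basis.prems by (simp add: U)
  qed
qed blast+

text \<open>For q = B f and a neighbourhood of q, replacing the tails of \<open>f\<close> beyond the
  interval that the neighbourhood sees gives a point of \<open>E\<close> inside it. The value
  \<open>c\<close> is 0 for \<open>E1\<close> and 1 for \<open>E2\<close>.\<close>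

lemma closure_of_eq_range_miura:
  assumes "E \<subseteq> range miura"
    and tails: "\<And>f N. f \<in> L2_loc_functions \<Longrightarrow> miura (abs_L2_loc (replace_tails (Suc N) c f)) \<in> E"
  shows "subtopology Hm1_loc_topology (range miura) closure_of E = range miura"
proof
  have top: "topspace (subtopology Hm1_loc_topology (range miura)) = range miura"
    using miura_Hm1_loc by (auto simp: topspace_Hm1_loc)
  then show "subtopology Hm1_loc_topology (range miura) closure_of E \<subseteq> range miura"
    by (metis closure_of_subset_topspace)
  show "range miura \<subseteq> subtopology Hm1_loc_topology (range miura) closure_of E"
    unfolding subset_iff in_closure_of top
  proof (intro allI impI conjI)
    fix q T assume "q \<in> range miura" and T: "q \<in> T \<and> openin (subtopology Hm1_loc_topology (range miura)) T"
    then obtain f where f: "f \<in> L2_loc_functions" "q = miura (abs_L2_loc f)"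
      by (metis abs_L2_loc_cases rangeE)
    obtain U where U: "openin Hm1_loc_topology U" "T = U \<inter> range miura"
      using T by (auto simp: openin_subtopology)
    then obtain N where N: "\<And>p. p \<in> Hm1_loc \<Longrightarrow>
        (\<forall>\<phi>\<in>test_functions. (\<forall>x. real N \<le> \<bar>x\<bar> \<longrightarrow> \<phi> x = 0) \<longrightarrow> p \<phi> = q \<phi>) \<Longrightarrow> p \<in> U"
      using openin_Hm1_loc_local[of U q] T by blast
    let ?p = "miura (abs_L2_loc (replace_tails (Suc N) c f))"
    have "?p \<in> U"
      using miura_replace_tails[OF f(1)] f(2) by (intro N miura_Hm1_loc) blast
    then show "\<exists>p. p \<in> E \<and> p \<in> T"
      using tails[OF f(1)] U by blast
  qed
qed

theorem theorem1p3:
  "range miura = E1 \<union> E2 \<and>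
   subtopology Hm1_loc_topology (range miura) closure_of E1 = range miura \<and>
   subtopology Hm1_loc_topology (range miura) closure_of E2 = range miura"
proof (intro conjI)
  show "range miura = E1 \<union> E2" by (rule range_miura_eq)
  show "subtopology Hm1_loc_topology (range miura) closure_of E1 = range miura"
    by (rule closure_of_eq_range_miura[OF _ replace_tails_0_E1]) (auto simp: E1_def)
  show "subtopology Hm1_loc_topology (range miura) closure_of E2 = range miura"
    by (rule closure_of_eq_range_miura[OF _ replace_tails_1_E2]) (auto simp: E2_def)
qed

end
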